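(* Let $f(w)=\frac1n\sum_{j=1}^n f_j(w)$ on $\mathbb{R}^d$ with each $f_j$ $L$-smooth, let $g:\mathbb{R}^d\to\mathbb{R}$ be Lipschitz continuous with parameter $l$ and such that $\operatorname{prox}_{\lambda g}(w)\neq\emptyset$ for all $w\in\mathbb{R}^d$, $\lambda>0$, let $h=f+g$ have a global minimizer $w^*$, let $\tilde w^1\in\mathbb{R}^d$, and put $\Delta=36(h(\tilde w^1)-h(w^* ))$. Run algorithm VRSGA (defined in the context) with $\alpha=\theta=\frac13$ from $\tilde w^1$. Then an $\epsilon$-stationary solution is obtained with gradient call complexity $O(n^{2/3}\epsilon^{-3})$ and proximal operator complexity $O(\epsilon^{-3})$. That is, there is a constant $C$ depending only on $L,l,\Delta$ (not on $n$) and an $\epsilon_0>0$ (which may depend on the problem instance, including $n$) such that for every $\epsilon\in(0,\epsilon_0)$ there is $N\in\mathbb{Z}_{>0}$ for which the output $\bar w^R_T$ of VRSGA with inputs $\tilde w^1,N,\alpha=\theta=\frac13$ satisfies $$\mathbb{E}\left[\operatorname{dist}(0,\partial h(\bar w^R_T))\right]\le\epsilon,$$ while the algorithm uses at most $Cn^{2/3}\epsilon^{-3}$ gradient calls and at most $C\epsilon^{-3}$ proximal operations.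
   Context: A function $f$ is $L$-smooth if it is differentiable and $\|\nabla f(w)-\nabla f(x)\|_2\le L\|w-x\|_2$ for all $w,x$. Subdifferential: $\hat\partial h(w)=\{v:\liminf_{x\to w,x\ne w}\frac{h(x)-h(w)-\langle v,x-w\rangle}{\|x-w\|_2}\ge0\}$, and the limiting subdifferential is $\partial h(w)=\{v:\exists\, w^k\to w,\ h(w^k)\to h(w),\ v^k\in\hat\partial h(w^k),\ v^k\to v\}$. Proximal operator: $\operatorname{prox}_{\lambda g}(w)=\operatorname{argmin}_{x\in\mathbb{R}^d}\{\frac1{2\lambda}\|w-x\|_2^2+g(x)\}$. A (measurable) selection $\zeta^\lambda(w)\in\operatorname{prox}_{\lambda g}(w)$ is fixed. Algorithm VRSGA. Input: $\tilde w^1\in\mathbb{R}^d$, $N\in\mathbb{Z}_{>0}$, $\alpha,\theta\in\mathbb{R}$. Set $m=\lceil n^\alpha\rceil$, $b=m^2$, $S=\lceil N/m\rceil$, $\lambda=(Sm)^{-\theta}$, $L_{E\lambda}=L+\frac1\lambda$, $\gamma=\frac1{6L_{E\lambda}}$. Draw $R$ uniformly from $\{1,\dots,S\}$. For $k=1,\dots,R$: set $w^k_1=\tilde w^k$ and $G^k=\nabla f(\tilde w^k)$; for $t=1,\dots,m$ draw a fresh multiset $I$ of $b$ indices i.i.d. uniform on $\{1,\dots,n\}$ and set $$V^k_t=\frac1b\sum_{j\in I}\big(\nabla f_j(w^k_t)-\nabla f_j(\tilde w^k)\big)+G^k+\frac1\lambda\big(w^k_t-\zeta^\lambda(w^k_t)\big),\qquad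 w^k_{t+1}=w^k_t-\gamma V^k_t;$$ then set $\tilde w^{k+1}=w^k_{m+1}$. Draw $T$ uniformly from $\{1,\dots,m\}$. ($R$, $T$ and all index samples are mutually independent.) Output: $\bar w^R_T=\zeta^\lambda(w^R_T)\in\operatorname{prox}_{\lambda g}(w^R_T)$. A gradient call is one evaluation of $\nabla f_j(w)$ for given $j$ and $w$ (so computing $\nabla f(w)$ costs $n$ calls); a proximal operation is one evaluation of $\zeta^\lambda$. An $\epsilon$-stationary solution is a (random) $\bar w$ with $\mathbb{E}[\operatorname{dist}(0,\partial h(\bar w))]\le\epsilon$. *)

theory Defs
  imports "HOL-Probability.Probability"
begin

section \<open>Euclidean spaces of arbitrary dimension inside one type\<close>

text \<open>
  The constant in the complexity bound must not depend on the dimension \<open>d\<close>, so \<open>d\<close> has to be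
  quantified inside the statement and cannot be a type parameter as in \<open>real ^ 'd\<close>.  We therefore use
  the space of finitely supported real sequences with the Euclidean inner product; the \<open>d\<close>-dimensional
  Euclidean space is its subspace \<open>Rn d\<close> of sequences supported on the first \<open>d\<close> coordinates
  (the convention of \<^const>\<open>Euclidean_space\<close>).  The type \<open>'a \<Rightarrow>\<^sub>0 real\<close> of the library is not
  suitable, because its norm is the sum of the absolute values of the coordinates.
\<close>

typedef seqvec = "{x :: nat \<Rightarrow> real. finite {i. x i \<noteq> 0}}"
  morphisms coord Abs_seqvec
  by (rule exI[of _ "\<lambda>_. 0"]) simp

setup_lifting type_definition_seqvec

lemma finite_coord: "finite {i. coord x i \<noteq> 0}"
  using coord[of x] by simp

lemma seqvec_eqI: "(\<And>i. coord x i = coord y i) \<Longrightarrow> x = y"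
  by (metis coord_inject ext)

instantiation seqvec :: real_vector
begin

lift_definition zero_seqvec :: seqvec is "\<lambda>_. 0" by simp
lift_definition plus_seqvec :: "seqvec \<Rightarrow> seqvec \<Rightarrow> seqvec" is "\<lambda>x y i. x i + y i"
  subgoal for x y by (rule finite_subset[of _ "{i. x i \<noteq> 0} \<union> {i. y i \<noteq> 0}"]) auto
  done
lift_definition minus_seqvec :: "seqvec \<Rightarrow> seqvec \<Rightarrow> seqvec" is "\<lambda>x y i. x i - y i"
  subgoal for x y by (rule finite_subset[of _ "{i. x i \<noteq> 0} \<union> {i. y i \<noteq> 0}"]) auto
  done
lift_definition uminus_seqvec :: "seqvec \<Rightarrow> seqvec" is "\<lambda>x i. - x i" by simp
lift_definition scaleR_seqvec :: "real \<Rightarrow> seqvec \<Rightarrow> seqvec" is "\<lambda>c x i. c * x i"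
  by (erule finite_subset[rotated]) auto

instance
  by standard (transfer, simp add: algebra_simps)+

end

lemmas coord_simps [simp] =
  zero_seqvec.rep_eq plus_seqvec.rep_eq minus_seqvec.rep_eq uminus_seqvec.rep_eq scaleR_seqvec.rep_eq

lemma coord_sum: "coord (\<Sum>a\<in>A. u a) i = (\<Sum>a\<in>A. coord (u a) i)"
  by (induction A rule: infinite_finite_induct) auto

instantiation seqvec :: real_inner
begin

definition inner_seqvec :: "seqvec \<Rightarrow> seqvec \<Rightarrow> real" where
  "inner_seqvec x y = (\<Sum>i | coord x i \<noteq> 0. coord x i * coord y i)"

definition norm_seqvec :: "seqvec \<Rightarrow> real" where
  "norm_seqvec x = sqrt (inner x x)"

definition dist_seqvec :: "seqvec \<Rightarrow> seqvec \<Rightarrow> real" where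
  "dist_seqvec x y = norm (x - y)"

definition sgn_seqvec :: "seqvec \<Rightarrow> seqvec" where
  "sgn_seqvec x = x /\<^sub>R norm x"

definition uniformity_seqvec :: "(seqvec \<times> seqvec) filter" where
  "uniformity_seqvec = (INF e\<in>{0<..}. principal {(x, y). dist x y < e})"

definition open_seqvec :: "seqvec set \<Rightarrow> bool" where
  "open_seqvec U = (\<forall>x\<in>U. \<forall>\<^sub>F (x', y) in uniformity. x' = x \<longrightarrow> y \<in> U)"

lemma inner_seqvec_superset:
  assumes "finite A" "{i. coord x i \<noteq> 0} \<subseteq> A"
  shows "inner x y = (\<Sum>i\<in>A. coord x i * coord y i)"
  unfolding inner_seqvec_def by (rule sum.mono_neutral_left) (use assms in auto)

instance
proof
  fix x y z :: seqvec and r :: real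
  let ?A = "{i. coord x i \<noteq> 0} \<union> {i. coord y i \<noteq> 0} \<union> {i. coord z i \<noteq> 0}"
  have A: "finite ?A" by (simp add: finite_coord)
  note S = inner_seqvec_superset[OF A]
  show "inner x y = inner y x"
    by (subst (1 2) S) (auto simp: mult.commute)
  have "{i. coord (x + y) i \<noteq> 0} \<subseteq> ?A" by auto
  then show "inner (x + y) z = inner x z + inner y z"
    by (subst (1 2 3) S) (auto simp: algebra_simps sum.distrib)
  have "{i. coord (r *\<^sub>R x) i \<noteq> 0} \<subseteq> ?A" by auto
  then show "inner (r *\<^sub>R x) y = r * inner x y"
    by (subst (1 2) S) (auto simp: algebra_simps sum_distrib_left)
  show "0 \<le> inner x x"
    unfolding inner_seqvec_def by (rule sum_nonneg) simp
  have "inner x x = 0 \<longleftrightarrow> (\<forall>i\<in>{i. coord x i \<noteq> 0}. coord x i * coord x i = 0)"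
    unfolding inner_seqvec_def by (rule sum_nonneg_eq_0_iff) (simp_all add: finite_coord)
  then show "inner x x = 0 \<longleftrightarrow> x = 0"
    by (auto intro: seqvec_eqI)
qed (simp_all add: norm_seqvec_def dist_seqvec_def sgn_seqvec_def uniformity_seqvec_def
      open_seqvec_def)

end

definition Rn :: "nat \<Rightarrow> seqvec set" where
  "Rn d = {x. \<forall>i\<ge>d. coord x i = 0}"

lemma coord_Rn: "coord ` Rn d = topspace (Euclidean_space d)"
proof -
  have "x \<in> coord ` Rn d" if "\<forall>i\<ge>d. x i = 0" for x
  proof -
    have "finite {i. x i \<noteq> 0}"
      by (rule finite_subset[of _ "{..<d}"]) (use that in \<open>auto simp: not_le[symmetric]\<close>)
    then have "coord (Abs_seqvec x) = x" by (simp add: Abs_seqvec_inverse)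
    with that show ?thesis by (intro image_eqI[of _ _ "Abs_seqvec x"]) (auto simp: Rn_def)
  qed
  then show ?thesis by (auto simp: topspace_Euclidean_space Rn_def)
qed

lemma inner_Rn:
  assumes "x \<in> Rn d"
  shows "inner x y = (\<Sum>i<d. coord x i * coord y i)"
  by (rule inner_seqvec_superset) (use assms in \<open>auto simp: Rn_def not_le[symmetric]\<close>)

lemma norm_Rn: "x \<in> Rn d \<Longrightarrow> norm x = L2_set (coord x) {..<d}"
  by (simp add: norm_eq_sqrt_inner inner_Rn L2_set_def power2_eq_square)

lemma subspace_Rn: "subspace (Rn d)"
  by (auto simp: subspace_def Rn_def)

section \<open>Smoothness, subdifferentials, proximal operator\<close>

text \<open>
  The ambient Euclidean space is a subspace \<open>E\<close>; all notions only see values of functions on \<open>E\<close>.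
\<close>

definition grad :: "'a::real_inner set \<Rightarrow> ('a \<Rightarrow> real) \<Rightarrow> 'a \<Rightarrow> 'a" where
  "grad E f w = (THE v. v \<in> E \<and> (f has_derivative (\<lambda>x. inner v x)) (at w within E))"

definition smooth_on :: "real \<Rightarrow> 'a::real_inner set \<Rightarrow> ('a \<Rightarrow> real) \<Rightarrow> bool" where
  "smooth_on L E f \<longleftrightarrow> f differentiable_on E \<and>
     (\<forall>w\<in>E. \<forall>x\<in>E. norm (grad E f w - grad E f x) \<le> L * norm (w - x))"

definition frechet_subdiff :: "'a::real_inner set \<Rightarrow> ('a \<Rightarrow> real) \<Rightarrow> 'a \<Rightarrow> 'a set" where
  "frechet_subdiff E h w =
     {v\<in>E. 0 \<le> Liminf (at w within E) (\<lambda>x. ereal ((h x - h w - inner v (x - w)) / norm (x - w)))}"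

definition limiting_subdiff :: "'a::real_inner set \<Rightarrow> ('a \<Rightarrow> real) \<Rightarrow> 'a \<Rightarrow> 'a set" where
  "limiting_subdiff E h w =
     {v\<in>E. \<exists>ws vs. (\<forall>k. ws k \<in> E) \<and> ws \<longlonglongrightarrow> w \<and> (\<lambda>k. h (ws k)) \<longlonglongrightarrow> h w \<and>
                   (\<forall>k. vs k \<in> frechet_subdiff E h (ws k)) \<and> vs \<longlonglongrightarrow> v}"

definition prox :: "'a::real_inner set \<Rightarrow> real \<Rightarrow> ('a \<Rightarrow> real) \<Rightarrow> 'a \<Rightarrow> 'a set" where
  "prox E lam g w =
     {x. is_arg_min (\<lambda>x. 1 / (2 * lam) * (norm (w - x))\<^sup>2 + g x) (\<lambda>x. x \<in> E) x}"

text \<open>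
  Unlike \<^const>\<open>infdist\<close>, which is \<open>0\<close> for the empty set, the distance to the empty set is infinite here.
\<close>

definition edist_set :: "'a::metric_space \<Rightarrow> 'a set \<Rightarrow> ennreal" where
  "edist_set x A = (INF a\<in>A. ennreal (dist x a))"

definition eps_stationary ::
  "'a::real_inner set \<Rightarrow> ('a \<Rightarrow> real) \<Rightarrow> real \<Rightarrow> 'a pmf \<Rightarrow> bool" where
  "eps_stationary E h \<epsilon> P \<longleftrightarrow>
     (\<integral>\<^sup>+ w. edist_set 0 (limiting_subdiff E h w) \<partial>measure_pmf P) \<le> ennreal \<epsilon>"

section \<open>The algorithm\<close>

definition finite_avg :: "nat \<Rightarrow> (nat \<Rightarrow> 'a \<Rightarrow> real) \<Rightarrow> 'a \<Rightarrow> real" where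
  "finite_avg n F w = 1 / real n * (\<Sum>j=1..n. F j w)"

definition vr_direction ::
  "'a::real_inner set \<Rightarrow> (nat \<Rightarrow> 'a \<Rightarrow> real) \<Rightarrow> real \<Rightarrow> ('a \<Rightarrow> 'a) \<Rightarrow> nat \<Rightarrow> 'a \<Rightarrow> 'a \<Rightarrow> 'a \<Rightarrow> nat list \<Rightarrow> 'a"
  where
  "vr_direction E F lam p b wt G w I =
     (1 / real b) *\<^sub>R (\<Sum>j\<leftarrow>I. grad E (F j) w - grad E (F j) wt) + G + (1 / lam) *\<^sub>R (w - p w)"

text \<open>
  A minibatch is a multiset; it is drawn here as the list of its \<open>b\<close> independent draws, and
  \<^const>\<open>vr_direction\<close> does not depend on their order.
  The program carries two counters along: gradient calls and proximal operations.  One inner iteration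
  evaluates two gradients per sampled index and one proximal point; an epoch additionally evaluates
  one full gradient, which costs \<open>n\<close> calls.  After \<open>t\<close> inner iterations the list consists of the iterates
  with indices \<open>1, \<dots>, t + 1\<close> of the epoch.
\<close>

primrec vrsga_inner ::
  "'a::real_inner set \<Rightarrow> nat \<Rightarrow> (nat \<Rightarrow> 'a \<Rightarrow> real) \<Rightarrow> real \<Rightarrow> ('a \<Rightarrow> 'a) \<Rightarrow> nat \<Rightarrow> real \<Rightarrow> 'a \<Rightarrow> 'a \<Rightarrow>
   nat \<times> nat \<Rightarrow> nat \<Rightarrow> ('a list \<times> nat \<times> nat) pmf" where
  "vrsga_inner E n F lam p b \<gamma> wt G c 0 = return_pmf ([wt], c)"
| "vrsga_inner E n F lam p b \<gamma> wt G c (Suc t) = do {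
     (ws, gc, pc) \<leftarrow> vrsga_inner E n F lam p b \<gamma> wt G c t;
     I \<leftarrow> replicate_pmf b (pmf_of_set {1..n});
     return_pmf (ws @ [last ws - \<gamma> *\<^sub>R vr_direction E F lam p b wt G (last ws) I],
                 gc + 2 * length I, pc + 1) }"

primrec vrsga_epochs ::
  "'a::real_inner set \<Rightarrow> nat \<Rightarrow> (nat \<Rightarrow> 'a \<Rightarrow> real) \<Rightarrow> real \<Rightarrow> ('a \<Rightarrow> 'a) \<Rightarrow> nat \<Rightarrow> nat \<Rightarrow> real \<Rightarrow> 'a \<Rightarrow>
   nat \<Rightarrow> ('a list \<times> nat \<times> nat) pmf" where
  "vrsga_epochs E n F lam p m b \<gamma> w1 0 = return_pmf ([w1], 0, 0)"
| "vrsga_epochs E n F lam p m b \<gamma> w1 (Suc k) = do {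
     (ws, gc, pc) \<leftarrow> vrsga_epochs E n F lam p m b \<gamma> w1 k;
     let wt = last ws;
     vrsga_inner E n F lam p b \<gamma> wt (grad E (finite_avg n F) wt) (gc + n, pc) m }"

text \<open>
  The result is the joint distribution of the output and of the two counters; the last proximal
  operation is the evaluation of the output itself.
\<close>

definition vrsga ::
  "'a::real_inner set \<Rightarrow> nat \<Rightarrow> (nat \<Rightarrow> 'a \<Rightarrow> real) \<Rightarrow> real \<Rightarrow> (real \<Rightarrow> 'a \<Rightarrow> 'a) \<Rightarrow>
   'a \<Rightarrow> nat \<Rightarrow> real \<Rightarrow> real \<Rightarrow> ('a \<times> nat \<times> nat) pmf" where
  "vrsga E n F L \<zeta> w1 N \<alpha> \<theta> =
     (let m = nat \<lceil>real n powr \<alpha>\<rceil>;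
          b = m\<^sup>2;
          S = nat \<lceil>real N / real m\<rceil>;
          lam = real (S * m) powr (- \<theta>);
          LE = L + 1 / lam;
          \<gamma> = 1 / (6 * LE)
      in do {
        R \<leftarrow> pmf_of_set {1..S};
        (ws, gc, pc) \<leftarrow> vrsga_epochs E n F lam (\<zeta> lam) m b \<gamma> w1 R;
        T \<leftarrow> pmf_of_set {1..m};
        return_pmf (\<zeta> lam (ws ! (T - 1)), gc, pc + 1) })"

end

theory Submission
  imports Defs
begin

text \<open>
  For the selection \<open>p = \<zeta> lam\<close>, the Moreau envelope \<open>M w = f w + \<parallel>w - p w\<parallel>\<^sup>2 / (2 * lam) + g (p w)\<close> is
  majorized around \<open>w\<close> by an \<open>L + 1 / lam\<close>-smooth function with gradient
  \<open>G w = \<nabla>f w + (w - p w) / lam\<close>, although \<open>M\<close> need not be differentiable.  The direction of the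
  algorithm is an unbiased estimate of \<open>G w\<close> whose variance is at most
  \<open>(L\<^sup>2 / b) * \<parallel>w - wt\<parallel>\<^sup>2\<close>, where \<open>wt\<close> is the snapshot.  Hence \<open>M w + c\<^sub>t * \<parallel>w - wt\<parallel>\<^sup>2\<close>, with
  weights \<open>c\<^sub>t\<close> decreasing linearly to \<open>0\<close> along an epoch, drops in expectation by \<open>\<gamma> / 2 * \<parallel>G w\<parallel>\<^sup>2\<close>
  per iteration, and telescoping over all \<open>S * m\<close> iterations bounds the mean of \<open>\<parallel>G\<parallel>\<^sup>2\<close> at the random
  iterate by \<open>O((S * m) powr (- 2 / 3))\<close>.  By optimality of \<open>p w\<close> the vector
  \<open>\<nabla>f (p w) + (w - p w) / lam\<close> is a subgradient of \<open>h\<close> at \<open>p w\<close>, and it differs from \<open>G w\<close> by at most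
  \<open>L * \<parallel>w - p w\<parallel> \<le> 2 * L * l * lam\<close>.
\<close>

section \<open>Gradients relative to a subspace\<close>

text \<open>Lines with base point and direction in \<open>E\<close> stay in \<open>E\<close>, so a
  derivative within \<open>E\<close> becomes an ordinary one-variable derivative along them;
  uniqueness of gradients and the descent inequality both rest on this.\<close>

lemma DERIV_along_line:
  assumes "subspace E" "w \<in> E" "x \<in> E"
    and "(f has_derivative D) (at (w + t *\<^sub>R x) within E)"
  shows "((\<lambda>s. f (w + s *\<^sub>R x)) has_real_derivative D x) (at t)"
proof -
  have img: "(\<lambda>s. w + s *\<^sub>R x) ` UNIV \<subseteq> E"
    using assms(1-3) by (auto intro: subspace_add subspace_scale)
  have "((\<lambda>s. w + s *\<^sub>R x) has_derivative (\<lambda>s. s *\<^sub>R x)) (at t)"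
    by (auto intro!: derivative_eq_intros)
  then have "((\<lambda>s. f (w + s *\<^sub>R x)) has_derivative (\<lambda>s. D (s *\<^sub>R x))) (at t)"
    by (rule has_derivative_in_compose) (rule has_derivative_subset[OF assms(4) img])
  moreover have "(\<lambda>s. D (s *\<^sub>R x)) = (*) (D x)"
    using has_derivative_bounded_linear[OF assms(4)]
    by (simp add: fun_eq_iff linear_simps)
  ultimately show ?thesis by (simp add: has_field_derivative_def)
qed

text \<open>A derivative within \<open>E\<close> determines inner products with vectors of
  \<open>E\<close> only. Both candidates lie in \<open>E\<close>, so testing with
  \<open>u - v\<close> forces them to coincide.\<close>

lemma grad_eqI:
  assumes E: "subspace E" "w \<in> E" and v: "v \<in> E"
    and D: "(f has_derivative (\<lambda>x. inner v x)) (at w within E)"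
  shows "grad E f w = v"
  unfolding grad_def
proof (rule the_equality)
  fix u assume u: "u \<in> E \<and> (f has_derivative (\<lambda>x. inner u x)) (at w within E)"
  have "inner u x = inner v x" if "x \<in> E" for x
    using DERIV_along_line[OF E that, of f "\<lambda>x. inner u x" 0]
      DERIV_along_line[OF E that, of f "\<lambda>x. inner v x" 0] u D
    by (auto dest: DERIV_unique)
  from this[of "u - v"] have "inner (u - v) (u - v) = 0"
    using E u v by (simp add: inner_diff_left subspace_diff)
  then show "u = v" by simp
qed (use v D in simp)

definition unit_seqvec :: "nat \<Rightarrow> seqvec" where
  "unit_seqvec i = Abs_seqvec (\<lambda>j. if j = i then 1 else 0)"

lemma coord_unit_seqvec [simp]: "coord (unit_seqvec i) j = (if j = i then 1 else 0)"
  unfolding unit_seqvec_def by (subst Abs_seqvec_inverse) auto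

lemma Rn_eq_sum_units:
  assumes "x \<in> Rn d"
  shows "x = (\<Sum>i<d. coord x i *\<^sub>R unit_seqvec i)"
proof (rule seqvec_eqI)
  show "coord x i = coord (\<Sum>i<d. coord x i *\<^sub>R unit_seqvec i) i" for i
    using assms by (cases "i < d") (auto simp: coord_sum Rn_def if_distrib cong: if_cong)
qed

text \<open>The ambient space is not complete, so the representing vector is built from
  coordinates.\<close>

lemma Riesz_Rn:
  assumes "linear D"
  shows "\<exists>v\<in>Rn d. \<forall>x\<in>Rn d. D x = inner v x"
proof
  define v where "v = (\<Sum>i<d. D (unit_seqvec i) *\<^sub>R unit_seqvec i)"
  have c: "coord v i = (if i < d then D (unit_seqvec i) else 0)" for i
    by (auto simp: v_def coord_sum if_distrib cong: if_cong)
  then show v: "v \<in> Rn d" by (simp add: Rn_def)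
  show "\<forall>x\<in>Rn d. D x = inner v x"
  proof
    fix x assume x: "x \<in> Rn d"
    have "D x = (\<Sum>i<d. coord x i *\<^sub>R D (unit_seqvec i))"
      by (subst Rn_eq_sum_units[OF x])
        (simp add: linear_sum[OF assms] linear_scale[OF assms])
    also have "\<dots> = inner v x"
      using inner_Rn[OF v, of x] by (simp add: c mult.commute)
    finally show "D x = inner v x" .
  qed
qed

lemma
  assumes f: "f differentiable_on Rn d" and w: "w \<in> Rn d"
  shows grad_in_Rn: "grad (Rn d) f w \<in> Rn d"
    and has_derivative_grad_Rn:
      "(f has_derivative (\<lambda>x. inner (grad (Rn d) f w) x)) (at w within Rn d)"
proof -
  obtain D where D: "(f has_derivative D) (at w within Rn d)"
    using f w by (auto simp: differentiable_on_def differentiable_def)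
  then obtain v where v: "v \<in> Rn d" "\<forall>x\<in>Rn d. D x = inner v x"
    using Riesz_Rn has_derivative_linear by blast
  have "(f has_derivative (\<lambda>x. inner v x)) (at w within Rn d)"
    unfolding has_derivative_within
  proof (intro conjI bounded_linear_inner_right)
    \<comment> \<open>\<open>D\<close> and \<open>inner v\<close> are known to agree only on
      \<open>Rn d\<close>, but all increments \<open>y - w\<close> lie there.\<close>
    have eq: "\<forall>\<^sub>F y in at w within Rn d. (1 / norm (y - w)) *\<^sub>R (f y - (f w + D (y - w)))
        = (1 / norm (y - w)) *\<^sub>R (f y - (f w + inner v (y - w)))"
      using v w by (auto simp: eventually_at_filter subspace_diff[OF subspace_Rn])
    show "((\<lambda>y. (1 / norm (y - w)) *\<^sub>R (f y - (f w + inner v (y - w)))) \<longlongrightarrow> 0)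
        (at w within Rn d)"
      using D Lim_transform_eventually[OF _ eq] by (simp add: has_derivative_within)
  qed
  moreover from this have "grad (Rn d) f w = v"
    by (rule grad_eqI[OF subspace_Rn w v(1)])
  ultimately show "grad (Rn d) f w \<in> Rn d"
    "(f has_derivative (\<lambda>x. inner (grad (Rn d) f w) x)) (at w within Rn d)"
    using v by simp_all
qed

lemma descent_lemma:
  assumes E: "subspace E" "w \<in> E" "x \<in> E"
    and D: "\<And>y. y \<in> E \<Longrightarrow> (f has_derivative (\<lambda>z. inner (v y) z)) (at y within E)"
    and L: "\<And>y. y \<in> E \<Longrightarrow> norm (v y - v w) \<le> L * norm (y - w)"
  shows "f x \<le> f w + inner (v w) (x - w) + L / 2 * (norm (x - w))\<^sup>2"
proof -
  define u where "u = x - w"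
  have u: "u \<in> E" using E by (simp add: u_def subspace_diff)
  \<comment> \<open>Up to the constant \<open>f w\<close>, this is the excess of \<open>f\<close>
    over its quadratic model along the segment; the Lipschitz bound makes its derivative
    nonpositive, which replaces integrating the gradient.\<close>
  define \<phi> where "\<phi> t = f (w + t *\<^sub>R u) - t * inner (v w) u - L / 2 * (norm u)\<^sup>2 * t\<^sup>2" for t :: real
  have "\<phi> 1 \<le> \<phi> 0"
  proof (rule DERIV_nonpos_imp_nonincreasing[of 0 1 \<phi>])
    fix t :: real assume t: "0 \<le> t" "t \<le> 1"
    have wt: "w + t *\<^sub>R u \<in> E" using E u by (simp add: subspace_add subspace_scale)
    have "(\<phi> has_real_derivative inner (v (w + t *\<^sub>R u)) u - inner (v w) u - L * (norm u)\<^sup>2 * t) (at t)"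
      unfolding \<phi>_def
      by (rule derivative_eq_intros DERIV_along_line[OF E(1,2) u D[OF wt]] refl)+ simp
    moreover have "inner (v (w + t *\<^sub>R u)) u - inner (v w) u \<le> L * (norm u)\<^sup>2 * t"
    proof -
      have "inner (v (w + t *\<^sub>R u)) u - inner (v w) u \<le> norm (v (w + t *\<^sub>R u) - v w) * norm u"
        by (metis inner_diff_left norm_cauchy_schwarz)
      also have "\<dots> \<le> (L * (t * norm u)) * norm u"
        using L[OF wt] t by (intro mult_right_mono) auto
      finally show ?thesis by (simp add: power2_eq_square algebra_simps)
    qed
    ultimately show "\<exists>y. (\<phi> has_real_derivative y) (at t) \<and> y \<le> 0"
      by (intro exI conjI) auto
  qed simp
  then show ?thesis by (simp add: \<phi>_def u_def)
qed

section \<open>Finitely supported random variables\<close>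

lemma expectation_bind_finite:
  fixes h :: "'b \<Rightarrow> real"
  assumes "finite (set_pmf p)" "\<And>x. x \<in> set_pmf p \<Longrightarrow> finite (set_pmf (f x))"
  shows "measure_pmf.expectation (p \<bind> f) h
    = measure_pmf.expectation p (\<lambda>x. measure_pmf.expectation (f x) h)"
  using assms
  by (simp add: pmf_expectation_bind[of "set_pmf p"] integral_measure_pmf[of "set_pmf p"])

lemma expectation_mono_finite:
  fixes f g :: "'a \<Rightarrow> real"
  assumes "finite (set_pmf p)" "\<And>x. x \<in> set_pmf p \<Longrightarrow> f x \<le> g x"
  shows "measure_pmf.expectation p f \<le> measure_pmf.expectation p g"
  using assms by (intro integral_mono_AE integrable_measure_pmf_finite) (auto simp: AE_measure_pmf_iff)

text \<open>Jensen's inequality, read off from the nonnegativity of the variance.\<close>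

lemma expectation_le_sqrt:
  fixes f :: "'a \<Rightarrow> real"
  assumes "finite (set_pmf p)"
  shows "measure_pmf.expectation p f \<le> sqrt (measure_pmf.expectation p (\<lambda>x. (f x)\<^sup>2))"
proof -
  have "0 \<le> measure_pmf.variance p f" by simp
  also have "\<dots> = measure_pmf.expectation p (\<lambda>x. (f x)\<^sup>2) - (measure_pmf.expectation p f)\<^sup>2"
    using assms by (intro measure_pmf.variance_eq integrable_measure_pmf_finite)
  finally show ?thesis by (simp add: real_le_rsqrt)
qed

lemma finite_set_replicate_pmf: "finite (set_pmf p) \<Longrightarrow> finite (set_pmf (replicate_pmf b p))"
  using finite_lists_length_eq[of "set_pmf p" b] by (simp add: set_replicate_pmf in_lists_conv_set subset_iff Ball_def)

text \<open>Induction on the batch size, splitting off the first draw. The values sum to zero over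
  \<open>A\<close>, so mixed products vanish in the mean and the second moments of the draws add
  up.\<close>

lemma
  fixes y :: "'b \<Rightarrow> 'a::real_inner"
  assumes A: "finite A" "A \<noteq> {}" and y: "(\<Sum>j\<in>A. y j) = 0"
  shows minibatch_mean:
      "measure_pmf.expectation (replicate_pmf b (pmf_of_set A)) (\<lambda>I. inner z (\<Sum>j\<leftarrow>I. y j)) = 0"
    and minibatch_variance:
      "measure_pmf.expectation (replicate_pmf b (pmf_of_set A)) (\<lambda>I. (norm (\<Sum>j\<leftarrow>I. y j))\<^sup>2)
        = real b * ((\<Sum>j\<in>A. (norm (y j))\<^sup>2) / card A)"
proof -
  let ?P = "\<lambda>b. replicate_pmf b (pmf_of_set A)"
  have fin: "finite (set_pmf (?P b))" for b
    using A by (intro finite_set_replicate_pmf) simp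
  have [simp]: "integrable (measure_pmf (?P b)) h" for b and h :: "'b list \<Rightarrow> real"
    by (rule integrable_measure_pmf_finite[OF fin])
  have step: "measure_pmf.expectation (?P (Suc b)) h
      = (\<Sum>j\<in>A. measure_pmf.expectation (?P b) (\<lambda>I. h (j # I))) / card A" for b and h :: "'b list \<Rightarrow> real"
    using A fin by (simp add: expectation_bind_finite integral_pmf_of_set)
  have zero: "(\<Sum>j\<in>A. inner u (y j)) = 0" for u
    using y by (metis inner_sum_right inner_zero_right)
  show mean: "measure_pmf.expectation (?P b) (\<lambda>I. inner z (\<Sum>j\<leftarrow>I. y j)) = 0" for b z
  proof (induction b)
    case (Suc b)
    show ?case
      unfolding step using Suc by (simp add: inner_add_right zero)
  qed simp
  show "measure_pmf.expectation (?P b) (\<lambda>I. (norm (\<Sum>j\<leftarrow>I. y j))\<^sup>2)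
      = real b * ((\<Sum>j\<in>A. (norm (y j))\<^sup>2) / card A)"
  proof (induction b)
    case (Suc b)
    have "(norm (y j + v))\<^sup>2 = (norm (y j))\<^sup>2 + 2 * inner (y j) v + (norm v)\<^sup>2" for j v
      by (simp add: power2_norm_eq_inner inner_add_left inner_add_right inner_commute)
    then have "measure_pmf.expectation (?P (Suc b)) (\<lambda>I. (norm (\<Sum>j\<leftarrow>I. y j))\<^sup>2)
       = (\<Sum>j\<in>A. (norm (y j))\<^sup>2 + real b * ((\<Sum>j\<in>A. (norm (y j))\<^sup>2) / card A)) / card A"
      unfolding step using Suc by (simp add: mean)
    also have "\<dots> = real (Suc b) * ((\<Sum>j\<in>A. (norm (y j))\<^sup>2) / card A)"
      using A by (simp add: sum.distrib distrib_right add_divide_distrib)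
    finally show ?case .
  qed simp
qed

section \<open>The Moreau envelope of the regularizer\<close>

lemma prox_le:
  assumes "p \<in> prox E lam g w" "x \<in> E"
  shows "(norm (w - p))\<^sup>2 / (2 * lam) + g p \<le> (norm (w - x))\<^sup>2 / (2 * lam) + g x"
  using assms by (auto simp: prox_def is_arg_min_linorder)

text \<open>The point \<open>w\<close> itself competes in the minimization that defines
  \<open>p\<close>, so the quadratic cost of \<open>p\<close> is at most the gain
  \<open>g w - g p\<close>.\<close>

lemma norm_diff_prox_le:
  assumes g: "l-lipschitz_on E g" and lam: "0 < lam" and w: "w \<in> E" and p: "p \<in> prox E lam g w"
  shows "norm (w - p) \<le> 2 * lam * l"
proof (cases "norm (w - p) = 0")
  case True
  then show ?thesis using lam lipschitz_on_nonneg[OF g] by simp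
next
  case False
  have "p \<in> E" using p by (simp add: prox_def is_arg_min_def)
  then have "g w - g p \<le> l * norm (w - p)"
    using lipschitz_onD[OF g w] by (fastforce simp: dist_norm)
  then have "(norm (w - p))\<^sup>2 / (2 * lam) \<le> l * norm (w - p)"
    using prox_le[OF p w] by simp
  then have "norm (w - p) * norm (w - p) \<le> (2 * lam * l) * norm (w - p)"
    using lam by (simp add: field_simps power2_eq_square)
  with False show ?thesis by simp
qed

text \<open>By AM-GM the Lipschitz loss \<open>l * r\<close> is absorbed by
  \<open>r\<^sup>2 / (2 * lam)\<close> up to \<open>l\<^sup>2 * lam / 2\<close>; this bounds how far
  the envelope can lie below the function.\<close>

lemma moreau_ge:
  assumes g: "l-lipschitz_on E g" and lam: "0 < lam" and w: "w \<in> E" and x: "x \<in> E"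
  shows "g w - l\<^sup>2 * lam / 2 \<le> (norm (w - x))\<^sup>2 / (2 * lam) + g x"
proof -
  define r where "r = norm (w - x)"
  have "g w - g x \<le> l * r"
    using lipschitz_onD[OF g w x] by (simp add: dist_norm r_def)
  moreover have "0 \<le> (r - lam * l)\<^sup>2 / (2 * lam)" using lam by simp
  then have "l * r \<le> r\<^sup>2 / (2 * lam) + l\<^sup>2 * lam / 2"
    using lam by (simp add: power2_diff field_simps power2_eq_square)
  ultimately show ?thesis unfolding r_def by linarith
qed

text \<open>The quadratic lower bound keeps the difference quotient above
  \<open>- (K * norm (x - w))\<close>, which tends to 0.\<close>

lemma frechet_subdiffI:
  assumes v: "v \<in> E"
    and K: "\<And>x. x \<in> E \<Longrightarrow> - (K * (norm (x - w))\<^sup>2) \<le> h x - h w - inner v (x - w)"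
  shows "v \<in> frechet_subdiff E h w"
proof -
  let ?q = "\<lambda>x. (h x - h w - inner v (x - w)) / norm (x - w)"
  have "0 \<le> Liminf (at w within E) (\<lambda>x. ereal (?q x))"
    unfolding le_Liminf_iff
  proof (intro allI impI)
    fix y :: ereal assume y: "y < 0"
    obtain c :: real where c: "y < ereal c" "ereal c < 0"
      using y ereal_dense2 by blast
    have "((\<lambda>x. - (K * norm (x - w))) \<longlongrightarrow> - (K * norm (w - w))) (at w within E)"
      by (intro tendsto_intros)
    then have "\<forall>\<^sub>F x in at w within E. c < - (K * norm (x - w))"
      using c by (intro order_tendstoD) auto
    moreover have "- (K * norm (x - w)) \<le> ?q x" if "x \<in> E" "x \<noteq> w" for x
      using K[OF that(1)] that(2) by (simp add: field_simps power2_eq_square)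
    then have "\<forall>\<^sub>F x in at w within E. - (K * norm (x - w)) \<le> ?q x"
      by (auto simp: eventually_at_filter)
    ultimately show "\<forall>\<^sub>F x in at w within E. y < ereal (?q x)"
    proof eventually_elim
      case (elim x)
      then have "c < ?q x" by simp
      then show ?case using c(1) by (metis ereal_less(1) less_ereal.simps(1) less_trans)
    qed
  qed
  with v show ?thesis by (simp add: frechet_subdiff_def)
qed

lemma frechet_subdiff_subset_limiting:
  "w \<in> E \<Longrightarrow> frechet_subdiff E h w \<subseteq> limiting_subdiff E h w"
proof
  fix v assume "w \<in> E" "v \<in> frechet_subdiff E h w"
  then show "v \<in> limiting_subdiff E h w"
    unfolding limiting_subdiff_def
    by (intro CollectI conjI exI[of _ "\<lambda>_. w"] exI[of _ "\<lambda>_. v"])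
      (auto simp: frechet_subdiff_def)
qed

section \<open>Expected descent of the envelope\<close>

text \<open>Existence of gradients in \<open>E\<close> is assumed separately, because over a general
  subspace a derivative need not be represented by a vector; for \<open>Rn d\<close> this is
  supplied by \<open>prox_finite_sum_Rn\<close>. A single \<open>lam\<close> is fixed, as in one run
  of the algorithm.\<close>

locale prox_finite_sum =
  fixes E :: "'a::real_inner set" and n :: nat and F :: "nat \<Rightarrow> 'a \<Rightarrow> real" and L :: real
    and g :: "'a \<Rightarrow> real" and l lam :: real and p :: "'a \<Rightarrow> 'a"
  assumes subspace_E: "subspace E" and n_pos: "1 \<le> n" and L_nonneg: "0 \<le> L" and lam_pos: "0 < lam"
    and grad_in: "\<And>j w. j \<in> {1..n} \<Longrightarrow> w \<in> E \<Longrightarrow> grad E (F j) w \<in> E"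
    and has_derivative_grad: "\<And>j w. j \<in> {1..n} \<Longrightarrow> w \<in> E \<Longrightarrow>
      (F j has_derivative (\<lambda>x. inner (grad E (F j) w) x)) (at w within E)"
    and grad_lipschitz: "\<And>j w x. j \<in> {1..n} \<Longrightarrow> w \<in> E \<Longrightarrow> x \<in> E \<Longrightarrow>
      norm (grad E (F j) w - grad E (F j) x) \<le> L * norm (w - x)"
    and lipschitz_g: "l-lipschitz_on E g"
    and p_prox: "\<And>w. w \<in> E \<Longrightarrow> p w \<in> prox E lam g w"
begin

abbreviation "f \<equiv> finite_avg n F"
abbreviation "h w \<equiv> f w + g w"

text \<open>
  \<open>gmap w\<close> is the gradient at \<open>w\<close> of the smooth majorant
  \<open>x \<mapsto> f x + \<parallel>x - p w\<parallel>\<^sup>2 / (2 * lam) + g (p w)\<close> of the envelope, which touches it at \<open>w\<close>; the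
  envelope itself need not be differentiable.
\<close>

definition envelope :: "'a \<Rightarrow> real" where
  "envelope w = f w + (norm (w - p w))\<^sup>2 / (2 * lam) + g (p w)"

definition gmap :: "'a \<Rightarrow> 'a" where
  "gmap w = grad E f w + (1 / lam) *\<^sub>R (w - p w)"

lemma p_in: "w \<in> E \<Longrightarrow> p w \<in> E"
  using p_prox[of w] by (simp add: prox_def is_arg_min_def)

lemma l_nonneg: "0 \<le> l"
  using lipschitz_g by (rule lipschitz_on_nonneg)

lemma
  assumes w: "w \<in> E"
  shows grad_avg: "grad E f w = (1 / real n) *\<^sub>R (\<Sum>j=1..n. grad E (F j) w)"
    and has_derivative_avg: "(f has_derivative (\<lambda>x. inner (grad E f w) x)) (at w within E)"
    and grad_avg_in: "grad E f w \<in> E"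
proof -
  let ?v = "(1 / real n) *\<^sub>R (\<Sum>j=1..n. grad E (F j) w)"
  have v: "?v \<in> E"
    using subspace_E w by (intro subspace_scale subspace_sum grad_in)
  have "((\<lambda>w. 1 / real n * (\<Sum>j=1..n. F j w)) has_derivative
      (\<lambda>x. 1 / real n * (\<Sum>j=1..n. inner (grad E (F j) w) x))) (at w within E)"
    using w by (intro has_derivative_mult_right has_derivative_sum has_derivative_grad)
  then have D: "(f has_derivative (\<lambda>x. inner ?v x)) (at w within E)"
    by (simp add: finite_avg_def[abs_def] inner_sum_left)
  show *: "grad E f w = ?v" by (rule grad_eqI[OF subspace_E w v D])
  show "(f has_derivative (\<lambda>x. inner (grad E f w) x)) (at w within E)" "grad E f w \<in> E"
    unfolding * by (rule D v)+
qed

lemma grad_avg_lipschitz: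
  assumes "w \<in> E" "x \<in> E"
  shows "norm (grad E f w - grad E f x) \<le> L * norm (w - x)"
proof -
  have "grad E f w - grad E f x = (1 / real n) *\<^sub>R (\<Sum>j=1..n. grad E (F j) w - grad E (F j) x)"
    using assms by (simp add: grad_avg sum_subtractf scaleR_diff_right)
  moreover have "norm (\<Sum>j=1..n. grad E (F j) w - grad E (F j) x) \<le> real n * (L * norm (w - x))"
    using grad_lipschitz assms by (intro order_trans[OF norm_sum] order_trans[OF sum_bounded_above]) auto
  ultimately show ?thesis using n_pos by (simp add: field_simps)
qed

lemma descent_avg:
  assumes "w \<in> E" "x \<in> E"
  shows "f x \<le> f w + inner (grad E f w) (x - w) + L / 2 * (norm (x - w))\<^sup>2"
  using assms by (intro descent_lemma[OF subspace_E]) (auto intro: has_derivative_avg grad_avg_lipschitz)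

text \<open>The point \<open>p w\<close> competes in the minimization at \<open>x\<close>, which
  puts the envelope at \<open>x\<close> below the majorant built at \<open>w\<close>. The quadratic
  part of the majorant expands exactly, and \<open>f\<close> obeys the descent inequality.\<close>

lemma envelope_descent:
  assumes w: "w \<in> E" and x: "x \<in> E"
  shows "envelope x \<le> envelope w + inner (gmap w) (x - w) + (L + 1 / lam) / 2 * (norm (x - w))\<^sup>2"
proof -
  have "envelope x \<le> f x + (norm (x - p w))\<^sup>2 / (2 * lam) + g (p w)"
    using prox_le[OF p_prox[OF x] p_in[OF w]] by (simp add: envelope_def)
  moreover have "(norm (x - p w))\<^sup>2 = (norm (w - p w))\<^sup>2 + 2 * inner (w - p w) (x - w) + (norm (x - w))\<^sup>2"
    by (simp add: power2_norm_eq_inner inner_diff inner_commute)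
  then have "(norm (x - p w))\<^sup>2 / (2 * lam)
      = (norm (w - p w))\<^sup>2 / (2 * lam) + inner ((1 / lam) *\<^sub>R (w - p w)) (x - w)
        + (1 / lam) / 2 * (norm (x - w))\<^sup>2"
    using lam_pos by (simp add: add_divide_distrib)
  ultimately show ?thesis
    using descent_avg[OF w x]
    unfolding gmap_def envelope_def inner_add_left add_divide_distrib distrib_right by linarith
qed

lemma envelope_le: "w \<in> E \<Longrightarrow> envelope w \<le> h w"
  using prox_le[OF p_prox[of w], of w] by (simp add: envelope_def)

lemma envelope_ge: "w \<in> E \<Longrightarrow> h w - l\<^sup>2 * lam / 2 \<le> envelope w"
  using moreau_ge[OF lipschitz_g lam_pos _ p_in, of w w] by (simp add: envelope_def)

text \<open>The vector is even a Frechet subgradient: optimality of \<open>p w\<close> bounds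
  \<open>g\<close> from below and smoothness bounds \<open>f\<close> from below, each up to a
  quadratic error.\<close>

lemma subgradient_prox:
  assumes w: "w \<in> E"
  shows "grad E f (p w) + (1 / lam) *\<^sub>R (w - p w) \<in> limiting_subdiff E h (p w)"
proof -
  note pE = p_in[OF w]
  let ?v = "grad E f (p w) + (1 / lam) *\<^sub>R (w - p w)"
  have "?v \<in> frechet_subdiff E h (p w)"
  proof (rule frechet_subdiffI)
    show "?v \<in> E"
      using w pE by (intro subspace_add subspace_scale subspace_diff subspace_E grad_avg_in)
    fix x assume x: "x \<in> E"
    let ?r = "norm (x - p w)"
    \<comment> \<open>The descent inequality from \<open>x\<close> to \<open>p w\<close> involves
      the gradient at \<open>x\<close>; exchanging it for the gradient at \<open>p w\<close> costs
      \<open>L * ?r\<^sup>2\<close>, whence \<open>3 / 2\<close> instead of \<open>1 / 2\<close>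
      below.\<close>
    have "inner (grad E f x - grad E f (p w)) (p w - x) \<le> L * ?r\<^sup>2"
      using norm_cauchy_schwarz[of "grad E f x - grad E f (p w)" "p w - x"]
        mult_right_mono[OF grad_avg_lipschitz[OF x pE], of ?r]
      by (simp add: power2_eq_square norm_minus_commute)
    then have f: "- (3 / 2 * (L * ?r\<^sup>2)) \<le> f x - f (p w) - inner (grad E f (p w)) (x - p w)"
      using descent_avg[OF x pE]
      unfolding norm_minus_commute[of "p w"] inner_diff by (simp add: field_simps)
    have "(norm (w - x))\<^sup>2 = (norm (w - p w))\<^sup>2 - 2 * inner (w - p w) (x - p w) + ?r\<^sup>2"
      by (simp add: power2_norm_eq_inner inner_diff inner_commute)
    then have "(norm (w - x))\<^sup>2 / (2 * lam)
      = (norm (w - p w))\<^sup>2 / (2 * lam) - inner ((1 / lam) *\<^sub>R (w - p w)) (x - p w)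
        + 1 / (2 * lam) * ?r\<^sup>2"
      using lam_pos by (simp add: add_divide_distrib diff_divide_distrib)
    then have "- (1 / (2 * lam) * ?r\<^sup>2)
        \<le> g x - g (p w) - inner ((1 / lam) *\<^sub>R (w - p w)) (x - p w)"
      using prox_le[OF p_prox[OF w] x] by linarith
    with f show "- ((3 / 2 * L + 1 / (2 * lam)) * ?r\<^sup>2) \<le> h x - h (p w) - inner ?v (x - p w)"
      unfolding inner_add_left distrib_right mult.assoc by linarith
  qed
  then show ?thesis using frechet_subdiff_subset_limiting[OF pE] by blast
qed

lemma edist_limiting_subdiff_le:
  assumes w: "w \<in> E"
  shows "edist_set 0 (limiting_subdiff E h (p w)) \<le> ennreal (norm (gmap w) + 2 * L * l * lam)"
proof -
  let ?v = "grad E f (p w) + (1 / lam) *\<^sub>R (w - p w)"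
  have "?v = gmap w + (grad E f (p w) - grad E f w)" by (simp add: gmap_def)
  then have "norm ?v \<le> norm (gmap w) + L * norm (w - p w)"
    using grad_avg_lipschitz[OF p_in[OF w] w]
    by (metis add_left_mono norm_minus_commute norm_triangle_le)
  also have "\<dots> \<le> norm (gmap w) + L * (2 * lam * l)"
    using norm_diff_prox_le[OF lipschitz_g lam_pos w p_prox[OF w]] L_nonneg
    by (intro add_left_mono mult_left_mono)
  finally have "ennreal (dist 0 ?v) \<le> ennreal (norm (gmap w) + 2 * L * l * lam)"
    by (intro ennreal_leI) (simp add: algebra_simps)
  then show ?thesis
    unfolding edist_set_def by (rule INF_lower2[OF subgradient_prox[OF w]])
qed

declare One_nat_def [simp del]

section \<open>Step size and variance of the gradient estimate\<close>

definition stepsize :: real where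
  "stepsize = 1 / (6 * (L + 1 / lam))"

lemma stepsize_pos: "0 < stepsize"
  using L_nonneg lam_pos by (simp add: stepsize_def add_nonneg_pos)

lemma stepsize_le: "(L + 1 / lam) * stepsize = 1 / 6" "L * stepsize \<le> 1 / 6"
proof -
  have "0 < L + 1 / lam" using L_nonneg lam_pos by (simp add: add_nonneg_pos)
  then show *: "(L + 1 / lam) * stepsize = 1 / 6" by (simp add: stepsize_def)
  have "0 \<le> 1 / lam * stepsize" using stepsize_pos lam_pos by simp
  with * show "L * stepsize \<le> 1 / 6" unfolding distrib_right by linarith
qed

text \<open>Deviation of one sampled gradient difference from its mean over all indices; its
  minibatch average is the error of \<open>vr_direction\<close> as an estimate of
  \<open>gmap w\<close>.\<close>

definition noise :: "'a \<Rightarrow> 'a \<Rightarrow> nat \<Rightarrow> 'a" where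
  "noise wt w j = (grad E (F j) w - grad E (F j) wt) - (grad E f w - grad E f wt)"

lemma sum_noise:
  assumes "w \<in> E" "wt \<in> E"
  shows "(\<Sum>j=1..n. noise wt w j) = 0"
proof -
  have "(\<Sum>j=1..n. grad E (F j) x) = real n *\<^sub>R grad E f x" if "x \<in> E" for x
    using n_pos by (simp add: grad_avg[OF that])
  with assms show ?thesis
    unfolding noise_def sum_subtractf by (simp add: sum_constant_scaleR)
qed

text \<open>A variance is at most the second moment about 0, and each sampled difference is
  controlled by its own Lipschitz bound.\<close>

lemma noise_variance:
  assumes "w \<in> E" "wt \<in> E"
  shows "(\<Sum>j=1..n. (norm (noise wt w j))\<^sup>2) / n \<le> L\<^sup>2 * (norm (w - wt))\<^sup>2"
proof -
  let ?a = "\<lambda>j. grad E (F j) w - grad E (F j) wt"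
  let ?A = "grad E f w - grad E f wt"
  \<comment> \<open>Writing the cross term with the noise itself makes it vanish after summation
    over \<open>j\<close>.\<close>
  have "(norm (noise wt w j))\<^sup>2 = (norm (?a j))\<^sup>2 - 2 * inner ?A (noise wt w j) - (norm ?A)\<^sup>2" for j
    unfolding noise_def power2_norm_eq_inner by (simp add: inner_diff inner_commute)
  then have "(\<Sum>j=1..n. (norm (noise wt w j))\<^sup>2)
    = (\<Sum>j=1..n. (norm (?a j))\<^sup>2) - 2 * inner ?A (\<Sum>j=1..n. noise wt w j) - real n * (norm ?A)\<^sup>2"
    by (simp add: sum_subtractf sum_distrib_left inner_sum_right)
  also have "\<dots> \<le> (\<Sum>j=1..n. (norm (?a j))\<^sup>2)"
    by (simp add: sum_noise[OF assms])
  also have "\<dots> \<le> (\<Sum>j=1..n. (L * norm (w - wt))\<^sup>2)"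
    using assms by (intro sum_mono power_mono grad_lipschitz) auto
  finally show ?thesis using n_pos by (simp add: field_simps power_mult_distrib)
qed

lemma vr_direction_eq:
  assumes "length I = b" "1 \<le> b"
  shows "vr_direction E F lam p b wt (grad E f wt) w I
    = gmap w + (1 / real b) *\<^sub>R (\<Sum>j\<leftarrow>I. noise wt w j)"
proof -
  have "(\<Sum>j\<leftarrow>I. noise wt w j) = (\<Sum>j\<leftarrow>I. grad E (F j) w - grad E (F j) wt)
      - real (length I) *\<^sub>R (grad E f w - grad E f wt)"
    by (induction I) (simp_all add: noise_def algebra_simps)
  with assms show ?thesis
    by (simp add: vr_direction_def gmap_def scaleR_diff_right)
qed

lemma vr_direction_in:
  assumes "w \<in> E" "wt \<in> E" "set I \<subseteq> {1..n}"
  shows "vr_direction E F lam p b wt (grad E f wt) w I \<in> E"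
proof -
  have "(\<Sum>j\<leftarrow>I. grad E (F j) w - grad E (F j) wt) \<in> E"
    using assms(3)
  proof (induction I)
    case Nil
    then show ?case using subspace_E by (simp add: subspace_0)
  next
    case (Cons j I)
    then have "grad E (F j) w - grad E (F j) wt \<in> E"
      using assms by (intro subspace_diff subspace_E grad_in) auto
    with Cons show ?case using subspace_E by (simp add: subspace_add)
  qed
  with assms show ?thesis
    unfolding vr_direction_def
    by (intro subspace_add subspace_scale subspace_diff subspace_E grad_avg_in p_in)
qed

abbreviation "minibatch b \<equiv> replicate_pmf b (pmf_of_set {1..n})"

lemma set_minibatch: "I \<in> set_pmf (minibatch b) \<longleftrightarrow> set I \<subseteq> {1..n} \<and> length I = b"
  using n_pos by (auto simp: set_replicate_pmf)

lemma finite_minibatch: "finite (set_pmf (minibatch b))"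
  using n_pos by (intro finite_set_replicate_pmf) simp

text \<open>
  The cross term between \<open>w - wt\<close> and the step is split by Young's inequality with weight
  \<open>1 / (2 * m)\<close>; with this weight an increment \<open>B\<close> per iteration suffices as long as
  \<open>c \<le> m * B\<close>, so the weights \<open>c\<close> of an epoch of length \<open>m\<close> can be taken linear in the
  iteration number.
\<close>

lemma expected_descent_step:
  fixes m :: nat and c :: real
  assumes m: "1 \<le> m" and w: "w \<in> E" and wt: "wt \<in> E"
  defines "B \<equiv> stepsize * L\<^sup>2 / (4 * (real m)\<^sup>2)"
  assumes c: "0 \<le> c" "c \<le> B * real m"
  defines "step \<equiv> \<lambda>I. w - stepsize *\<^sub>R vr_direction E F lam p (m\<^sup>2) wt (grad E f wt) w I"
  shows "measure_pmf.expectation (minibatch (m\<^sup>2))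
      (\<lambda>I. envelope (step I) + c * (norm (step I - wt))\<^sup>2)
    \<le> envelope w + (c + B) * (norm (w - wt))\<^sup>2 - stepsize / 2 * (norm (gmap w))\<^sup>2"
proof -
  define s where "s = stepsize"
  define M where "M = real m"
  define d where "d = w - wt"
  define G where "G = gmap w"
  define \<delta> where "\<delta> I = (1 / real (m\<^sup>2)) *\<^sub>R (\<Sum>j\<leftarrow>I. noise wt w j)" for I
  \<comment> \<open>Collects the coefficients of all terms linear in the noise, so that they vanish
    together in expectation.\<close>
  define z where "z = (- (5 / 6 * s)) *\<^sub>R G - (2 * c * s) *\<^sub>R (d - s *\<^sub>R G)"
  let ?D = "envelope w - 11 / 12 * s * (norm G)\<^sup>2 + c * (norm (d - s *\<^sub>R G))\<^sup>2"
  have s: "0 < s" "L * s \<le> 1 / 6" "(L + 1 / lam) * s = 1 / 6"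
    using stepsize_pos stepsize_le by (simp_all add: s_def)
  have M: "1 \<le> M" using m by (simp add: M_def)
  have m2: "1 \<le> m\<^sup>2" using m by simp
  have B: "0 \<le> B" using s(1) by (simp add: B_def s_def[symmetric])
  have pointwise: "envelope (step I) + c * (norm (step I - wt))\<^sup>2
      \<le> ?D + inner z (\<delta> I) + (s / 12 + c * s\<^sup>2) * (norm (\<delta> I))\<^sup>2" if I: "I \<in> set_pmf (minibatch (m\<^sup>2))" for I
  proof -
    have I': "set I \<subseteq> {1..n}" "length I = m\<^sup>2" using I by (simp_all add: set_minibatch)
    have V: "step I = w - s *\<^sub>R (G + \<delta> I)"
      unfolding step_def vr_direction_eq[OF I'(2) m2] by (simp add: s_def G_def \<delta>_def)
    have "step I \<in> E"
      unfolding step_def using w wt I'(1)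
      by (intro subspace_diff subspace_scale subspace_E vr_direction_in)
    from envelope_descent[OF w this]
    have "envelope (step I) \<le> envelope w - s * inner G (G + \<delta> I)
        + (L + 1 / lam) * s / 2 * s * (norm (G + \<delta> I))\<^sup>2"
      using s(1) by (simp add: V G_def[symmetric] power_mult_distrib power2_eq_square mult_ac)
    \<comment> \<open>As \<open>(L + 1 / lam) * s = 1 / 6\<close>, the quadratic term has weight
      \<open>s / 12\<close>. This leaves \<open>1 - 1 / 12\<close> of the squared \<open>G\<close>
      and \<open>1 - 1 / 6\<close> of the linear noise term.\<close>
    also have "\<dots> = envelope w - 11 / 12 * s * (norm G)\<^sup>2 - 5 / 6 * s * inner G (\<delta> I)
        + s / 12 * (norm (\<delta> I))\<^sup>2"
      unfolding s(3) power2_norm_eq_inner by (simp add: inner_add inner_commute algebra_simps)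
    finally have 1: "envelope (step I) \<le> \<dots>" .
    have "step I - wt = (d - s *\<^sub>R G) - s *\<^sub>R \<delta> I" by (simp add: V d_def algebra_simps)
    then have "(norm (step I - wt))\<^sup>2 = (norm (d - s *\<^sub>R G))\<^sup>2 - 2 * s * inner (d - s *\<^sub>R G) (\<delta> I)
        + s\<^sup>2 * (norm (\<delta> I))\<^sup>2"
      unfolding power2_norm_eq_inner
      by (simp add: inner_diff_left[of "d - s *\<^sub>R G"] inner_diff_right[of _ "d - s *\<^sub>R G"]
          inner_commute[of "\<delta> I" "d - s *\<^sub>R G"] power2_eq_square
          right_diff_distrib)
    then have "c * (norm (step I - wt))\<^sup>2 = c * (norm (d - s *\<^sub>R G))\<^sup>2
        - 2 * c * s * inner (d - s *\<^sub>R G) (\<delta> I) + c * s\<^sup>2 * (norm (\<delta> I))\<^sup>2"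
      by (simp only:) (simp add: algebra_simps)
    with 1 show ?thesis
      unfolding z_def inner_diff_left inner_scaleR_left distrib_right by (simp add: inner_diff_left)
  qed
  have int: "integrable (measure_pmf (minibatch (m\<^sup>2))) u" for u :: "nat list \<Rightarrow> real"
    by (rule integrable_measure_pmf_finite[OF finite_minibatch])
  note fin = finite_atLeastAtMost[of 1 n]
  have ne: "{1..n} \<noteq> {}" using n_pos by simp
  have mean: "measure_pmf.expectation (minibatch (m\<^sup>2)) (\<lambda>I. inner z (\<delta> I)) = 0"
    using minibatch_mean[OF fin ne sum_noise[OF w wt], of "m\<^sup>2" z] by (simp add: \<delta>_def)
  have "measure_pmf.expectation (minibatch (m\<^sup>2)) (\<lambda>I. (norm (\<delta> I))\<^sup>2)
      = 1 / M\<^sup>2 * ((\<Sum>j=1..n. (norm (noise wt w j))\<^sup>2) / n)"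
    using minibatch_variance[OF fin ne sum_noise[OF w wt], of "m\<^sup>2"] M
    by (simp add: \<delta>_def power_divide M_def power2_eq_square)
  also have "\<dots> \<le> 1 / M\<^sup>2 * (L\<^sup>2 * (norm d)\<^sup>2)"
    unfolding d_def by (intro mult_left_mono noise_variance w wt) simp
  finally have var: "measure_pmf.expectation (minibatch (m\<^sup>2)) (\<lambda>I. (norm (\<delta> I))\<^sup>2)
      \<le> L\<^sup>2 / M\<^sup>2 * (norm d)\<^sup>2" by simp
  have young: "(norm (d - s *\<^sub>R G))\<^sup>2
      \<le> (1 + 1 / (2 * M)) * (norm d)\<^sup>2 + (1 + 2 * M) * s\<^sup>2 * (norm G)\<^sup>2"
  proof -
    have "0 \<le> (norm (d + (2 * M * s) *\<^sub>R G))\<^sup>2 / (2 * M)" using M by simp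
    also have "\<dots> = (norm d)\<^sup>2 / (2 * M) + 2 * s * inner d G + 2 * M * s\<^sup>2 * (norm G)\<^sup>2"
      unfolding power2_norm_eq_inner using M
      by (simp add: inner_add inner_commute field_simps power2_eq_square)
    finally have "0 \<le> \<dots>" .
    moreover have "(norm (d - s *\<^sub>R G))\<^sup>2 = (norm d)\<^sup>2 - 2 * s * inner d G + s\<^sup>2 * (norm G)\<^sup>2"
      unfolding power2_norm_eq_inner by (simp add: inner_diff inner_commute power2_eq_square)
    ultimately show ?thesis by (simp add: algebra_simps)
  qed
  have B_eq: "s * L\<^sup>2 / M\<^sup>2 = 4 * B" by (simp add: B_def s_def M_def)
  \<comment> \<open>The constant is \<open>(1 / 6)\<^sup>2 / 4\<close>, from
    \<open>L * s \<le> 1 / 6\<close> and the factor 4 in \<open>B\<close>.\<close>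
  have BM: "c * s \<le> 1 / (144 * M)"
  proof -
    have "c * s \<le> (B * M) * s" using c s(1) by (simp add: M_def)
    also have "\<dots> = (L * s)\<^sup>2 / (4 * M)"
      using M by (simp add: B_def s_def M_def power2_eq_square)
    also have "\<dots> \<le> (1 / 6)\<^sup>2 / (4 * M)"
      using M s L_nonneg by (intro divide_right_mono power_mono) auto
    finally show ?thesis by (simp add: power2_eq_square)
  qed
  \<comment> \<open>The increment \<open>B\<close> pays for \<open>B / 2\<close> from Young's
    inequality and, via \<open>B_eq\<close>, for \<open>B / 3\<close> and \<open>B / 36\<close> from
    the variance.\<close>
  have coeff_d: "c * (1 + 1 / (2 * M)) + (s / 12 + c * s\<^sup>2) * (L\<^sup>2 / M\<^sup>2) \<le> c + B"
  proof -
    have "c / (2 * M) \<le> B / 2" using c M by (simp add: M_def field_simps)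
    moreover have "(c * s) * (s * L\<^sup>2 / M\<^sup>2) \<le> 1 / 144 * (4 * B)"
      unfolding B_eq using M B by (intro mult_right_mono order_trans[OF BM]) (auto simp: field_simps)
    moreover have "(s / 12 + c * s\<^sup>2) * (L\<^sup>2 / M\<^sup>2) = (s * L\<^sup>2 / M\<^sup>2) / 12 + (c * s) * (s * L\<^sup>2 / M\<^sup>2)"
      by (simp add: distrib_right add_divide_distrib power2_eq_square)
    ultimately show ?thesis unfolding B_eq using B by (simp add: algebra_simps)
  qed
  \<comment> \<open>Keeping \<open>s / 2\<close> of the descent leaves \<open>5 / 12 * s\<close> to
    spend; by \<open>1 + 2 * M \<le> 3 * M\<close> and \<open>BM\<close> only \<open>s / 48\<close>
    is consumed.\<close>
  have coeff_G: "c * ((1 + 2 * M) * s\<^sup>2) \<le> 11 / 12 * s - s / 2"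
  proof -
    have "(c * s) * ((1 + 2 * M) * s) \<le> 1 / (144 * M) * ((3 * M) * s)"
      using M s(1) BM c by (intro mult_mono) auto
    also have "\<dots> \<le> 5 / 12 * s" using M s(1) by simp
    finally show ?thesis by (simp add: power2_eq_square mult_ac)
  qed
  have "measure_pmf.expectation (minibatch (m\<^sup>2)) (\<lambda>I. envelope (step I) + c * (norm (step I - wt))\<^sup>2)
      \<le> measure_pmf.expectation (minibatch (m\<^sup>2))
          (\<lambda>I. ?D + inner z (\<delta> I) + (s / 12 + c * s\<^sup>2) * (norm (\<delta> I))\<^sup>2)"
    by (intro expectation_mono_finite finite_minibatch pointwise)
  also have "\<dots> = ?D + (s / 12 + c * s\<^sup>2)
      * measure_pmf.expectation (minibatch (m\<^sup>2)) (\<lambda>I. (norm (\<delta> I))\<^sup>2)"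
    using mean int by simp
  also have "\<dots> \<le> envelope w - 11 / 12 * s * (norm G)\<^sup>2
      + c * ((1 + 1 / (2 * M)) * (norm d)\<^sup>2 + (1 + 2 * M) * s\<^sup>2 * (norm G)\<^sup>2)
      + (s / 12 + c * s\<^sup>2) * (L\<^sup>2 / M\<^sup>2 * (norm d)\<^sup>2)"
    using c(1) s(1) by (intro add_mono mult_left_mono young var) auto
  also have "\<dots> = envelope w - 11 / 12 * s * (norm G)\<^sup>2
      + (c * (1 + 1 / (2 * M)) + (s / 12 + c * s\<^sup>2) * (L\<^sup>2 / M\<^sup>2)) * (norm d)\<^sup>2
      + c * ((1 + 2 * M) * s\<^sup>2) * (norm G)\<^sup>2"
    by (simp add: distrib_left distrib_right)
  also have "\<dots> \<le> envelope w - 11 / 12 * s * (norm G)\<^sup>2 + (c + B) * (norm d)\<^sup>2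
      + (11 / 12 * s - s / 2) * (norm G)\<^sup>2"
    by (intro add_mono mult_right_mono coeff_d coeff_G) auto
  finally show ?thesis by (simp add: s_def d_def G_def algebra_simps)
qed

section \<open>Telescoping over one epoch and then over all epochs\<close>

abbreviation "inner_loop m wt \<equiv>
  vrsga_inner E n F lam p (m\<^sup>2) stepsize wt (grad E f wt)"

lemma set_inner_loop:
  assumes "wt \<in> E" "(ws, gc, pc) \<in> set_pmf (inner_loop m wt c t)"
  shows "set ws \<subseteq> E \<and> length ws = t + 1 \<and> gc = fst c + 2 * m\<^sup>2 * t \<and> pc = snd c + t"
  using assms(2)
proof (induction t arbitrary: ws gc pc)
  case 0
  then show ?case using assms(1) by (cases c) auto
next
  case (Suc t)
  then obtain ws' gc' pc' I where prev: "(ws', gc', pc') \<in> set_pmf (inner_loop m wt c t)"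
    and I: "I \<in> set_pmf (minibatch (m\<^sup>2))"
    and eq: "ws = ws' @ [last ws' - stepsize *\<^sub>R
        vr_direction E F lam p (m\<^sup>2) wt (grad E f wt) (last ws') I]"
      "gc = gc' + 2 * length I" "pc = pc' + 1"
    by auto
  note IH = Suc.IH[OF prev]
  then have "last ws' \<in> E" by (metis last_in_set list.size(3) add_is_0 one_neq_zero subsetD)
  with I assms(1) have "last ws' - stepsize *\<^sub>R
      vr_direction E F lam p (m\<^sup>2) wt (grad E f wt) (last ws') I \<in> E"
    by (intro subspace_diff subspace_scale subspace_E vr_direction_in) (auto simp: set_minibatch)
  with IH I show ?case by (auto simp: eq set_minibatch algebra_simps)
qed

lemma finite_inner_loop: "finite (set_pmf (inner_loop m wt c t))"
  by (induction t) (auto simp: finite_minibatch)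

text \<open>The last iterate is dropped: no step of this epoch starts there, and it becomes the next
  snapshot instead of a candidate for the output.\<close>

definition path_energy :: "'a list \<Rightarrow> real" where
  "path_energy ws = (\<Sum>w\<leftarrow>butlast ws. (norm (gmap w))\<^sup>2)"

text \<open>The distance term is absent at both ends of an epoch: at \<open>t = 0\<close> the
  iterate is the snapshot, and at \<open>t = m\<close> the weight is 0. Hence epochs can be chained
  through the envelope alone.\<close>

lemma inner_loop_descent:
  assumes m: "1 \<le> m" and wt: "wt \<in> E" and t: "t \<le> m"
  defines "B \<equiv> stepsize * L\<^sup>2 / (4 * (real m)\<^sup>2)"
  shows "measure_pmf.expectation (inner_loop m wt c t) (\<lambda>(ws, _).
      stepsize / 2 * path_energy ws + (envelope (last ws) + B * real (m - t) * (norm (last ws - wt))\<^sup>2))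
    \<le> envelope wt"
  using t
proof (induction t)
  case 0
  then show ?case by (simp add: path_energy_def)
next
  case (Suc t)
  let ?\<Phi> = "\<lambda>t ws. stepsize / 2 * path_energy ws
    + (envelope (last ws) + B * real (m - t) * (norm (last ws - wt))\<^sup>2)"
  let ?step = "\<lambda>w I. w - stepsize *\<^sub>R vr_direction E F lam p (m\<^sup>2) wt (grad E f wt) w I"
  have B: "0 \<le> B" using stepsize_pos by (simp add: B_def)
  have "measure_pmf.expectation (inner_loop m wt c (Suc t)) (\<lambda>(ws, _). ?\<Phi> (Suc t) ws)
    = measure_pmf.expectation (inner_loop m wt c t) (\<lambda>(ws, _).
        measure_pmf.expectation (minibatch (m\<^sup>2)) (\<lambda>I. ?\<Phi> (Suc t) (ws @ [?step (last ws) I])))"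
    by (simp add: expectation_bind_finite finite_inner_loop finite_minibatch case_prod_unfold)
  also have "\<dots> \<le> measure_pmf.expectation (inner_loop m wt c t) (\<lambda>(ws, _). ?\<Phi> t ws)"
  proof (intro expectation_mono_finite finite_inner_loop, clarify)
    fix ws gc pc assume "(ws, gc, pc) \<in> set_pmf (inner_loop m wt c t)"
    note ws = set_inner_loop[OF wt this]
    then have ne: "ws \<noteq> []" by auto
    with ws have lastE: "last ws \<in> E" by auto
    let ?c = "B * real (m - Suc t)"
    have c: "0 \<le> ?c" "?c \<le> B * real m" using B by (auto intro: mult_left_mono)
    \<comment> \<open>The weight given up from \<open>t\<close> to \<open>Suc t\<close> is exactly
      the increment granted by \<open>expected_descent_step\<close>.\<close>
    have cB: "?c + B = B * real (m - t)" using Suc.prems by (simp add: of_nat_diff algebra_simps)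
    have energy: "path_energy (ws @ [x]) = path_energy ws + (norm (gmap (last ws)))\<^sup>2" for x
      using ne by (cases ws rule: rev_cases) (auto simp: path_energy_def butlast_append)
    have "measure_pmf.expectation (minibatch (m\<^sup>2)) (\<lambda>I. ?\<Phi> (Suc t) (ws @ [?step (last ws) I]))
      = stepsize / 2 * path_energy ws + stepsize / 2 * (norm (gmap (last ws)))\<^sup>2
        + measure_pmf.expectation (minibatch (m\<^sup>2)) (\<lambda>I. envelope (?step (last ws) I)
          + ?c * (norm (?step (last ws) I - wt))\<^sup>2)"
      by (simp add: energy integrable_measure_pmf_finite finite_minibatch distrib_left)
    also have "\<dots> \<le> ?\<Phi> t ws"
      using expected_descent_step[OF m lastE wt c[unfolded B_def], folded B_def] unfolding cB by simp
    finally show "measure_pmf.expectation (minibatch (m\<^sup>2))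
        (\<lambda>I. ?\<Phi> (Suc t) (ws @ [?step (last ws) I])) \<le> ?\<Phi> t ws" .
  qed
  also have "\<dots> \<le> envelope wt" using Suc by simp
  finally show ?case .
qed

abbreviation "epochs m w1 \<equiv> vrsga_epochs E n F lam p m (m\<^sup>2) stepsize w1"

text \<open>Only the iterates of the latest epoch are kept; before the first epoch there is just the
  starting point, hence the case distinction.\<close>

lemma set_epochs:
  assumes "w1 \<in> E" "(ws, gc, pc) \<in> set_pmf (epochs m w1 k)"
  shows "set ws \<subseteq> E \<and> length ws = (if k = 0 then 1 else m + 1)
    \<and> gc = k * (n + 2 * m\<^sup>2 * m) \<and> pc = k * m"
  using assms(2)
proof (induction k arbitrary: ws gc pc)
  case 0
  then show ?case using assms(1) by auto
next
  case (Suc k)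
  then obtain ws' gc' pc' where prev: "(ws', gc', pc') \<in> set_pmf (epochs m w1 k)"
    and cur: "(ws, gc, pc) \<in> set_pmf (inner_loop m (last ws') (gc' + n, pc') m)"
    by (auto simp: Let_def)
  note IH = Suc.IH[OF prev]
  then have "ws' \<noteq> []" by (auto split: if_splits)
  with IH have "last ws' \<in> E" by auto
  from set_inner_loop[OF this cur] IH show ?case by (auto simp: algebra_simps)
qed

lemma finite_epochs: "finite (set_pmf (epochs m w1 k))"
  by (induction k) (auto simp: Let_def finite_inner_loop)

text \<open>Since earlier epochs are forgotten, the energy of epoch \<open>r\<close> is taken under
  the law of \<open>epochs m w1 r\<close> and the inequality telescopes over these laws.\<close>

lemma epochs_descent:
  assumes m: "1 \<le> m" and w1: "w1 \<in> E"
  shows "measure_pmf.expectation (epochs m w1 k) (\<lambda>(ws, _). envelope (last ws))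
      + stepsize / 2 * (\<Sum>r=1..k. measure_pmf.expectation (epochs m w1 r) (\<lambda>(ws, _). path_energy ws))
    \<le> envelope w1"
proof (induction k)
  case 0
  then show ?case by simp
next
  case (Suc k)
  have "measure_pmf.expectation (epochs m w1 (Suc k)) (\<lambda>(ws, _). envelope (last ws))
      + stepsize / 2 * measure_pmf.expectation (epochs m w1 (Suc k)) (\<lambda>(ws, _). path_energy ws)
    = measure_pmf.expectation (epochs m w1 (Suc k))
        (\<lambda>(ws, _). stepsize / 2 * path_energy ws + envelope (last ws))"
    by (simp del: vrsga_epochs.simps
        add: case_prod_unfold integrable_measure_pmf_finite finite_epochs)
  also have "\<dots> = measure_pmf.expectation (epochs m w1 k) (\<lambda>(ws, gc, pc).
      measure_pmf.expectation (inner_loop m (last ws) (gc + n, pc) m)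
        (\<lambda>(ws, _). stepsize / 2 * path_energy ws + envelope (last ws)))"
    by (simp add: expectation_bind_finite finite_epochs finite_inner_loop Let_def case_prod_unfold)
  also have "\<dots> \<le> measure_pmf.expectation (epochs m w1 k) (\<lambda>(ws, _). envelope (last ws))"
  proof (intro expectation_mono_finite finite_epochs, clarify)
    fix ws gc pc assume "(ws, gc, pc) \<in> set_pmf (epochs m w1 k)"
    note ws = set_epochs[OF w1 this]
    then have "ws \<noteq> []" by (auto split: if_splits)
    with ws have "last ws \<in> E" by auto
    from inner_loop_descent[OF m this order_refl]
    show "measure_pmf.expectation (inner_loop m (last ws) (gc + n, pc) m)
        (\<lambda>(ws, _). stepsize / 2 * path_energy ws + envelope (last ws)) \<le> envelope (last ws)"
      by simp
  qed
  finally show ?case using Suc by (simp del: vrsga_epochs.simps add: distrib_left)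
qed

text \<open>The envelope starts at most at \<open>h w1\<close> and ends at least at
  \<open>h wstar - l\<^sup>2 * lam / 2\<close>; the factor in front is
  \<open>2 / stepsize\<close>.\<close>

lemma sum_path_energy_le:
  assumes m: "1 \<le> m" and w1: "w1 \<in> E" and min: "is_arg_min h (\<lambda>w. w \<in> E) wstar"
  shows "(\<Sum>r=1..k. measure_pmf.expectation (epochs m w1 r) (\<lambda>(ws, _). path_energy ws))
    \<le> 12 * (L + 1 / lam) * (h w1 - h wstar + l\<^sup>2 * lam / 2)"
proof -
  have "h wstar - l\<^sup>2 * lam / 2 = measure_pmf.expectation (epochs m w1 k) (\<lambda>_. h wstar - l\<^sup>2 * lam / 2)"
    by simp
  also have "\<dots> \<le> measure_pmf.expectation (epochs m w1 k) (\<lambda>(ws, _). envelope (last ws))"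
  proof (intro expectation_mono_finite finite_epochs, clarify)
    fix ws gc pc assume "(ws, gc, pc) \<in> set_pmf (epochs m w1 k)"
    note ws = set_epochs[OF w1 this]
    then have "ws \<noteq> []" by (auto split: if_splits)
    with ws have "last ws \<in> E" by auto
    with min have "h wstar \<le> h (last ws)" by (simp add: is_arg_min_linorder)
    with envelope_ge[OF \<open>last ws \<in> E\<close>]
    show "h wstar - l\<^sup>2 * lam / 2 \<le> envelope (last ws)" by simp
  qed
  finally have D: "stepsize / 2 * (\<Sum>r=1..k. measure_pmf.expectation (epochs m w1 r) (\<lambda>(ws, _). path_energy ws))
      \<le> h w1 - h wstar + l\<^sup>2 * lam / 2"
    using epochs_descent[OF m w1, of k] envelope_le[OF w1] by linarith
  define A where "A = L + 1 / lam"
  have "0 < A" using L_nonneg lam_pos by (simp add: A_def add_nonneg_pos)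
  then have id: "x = 12 * A * (stepsize / 2 * x)" for x
    by (simp add: A_def stepsize_def)
  show ?thesis
    by (subst id) (use D \<open>0 < A\<close> in \<open>simp only: A_def[symmetric] mult_left_mono\<close>)
qed

section \<open>The random output and the complexity bound\<close>

text \<open>The run without counters and before the final prox evaluation; applying \<open>p\<close>
  yields the law of the output.\<close>

definition random_iterate :: "nat \<Rightarrow> nat \<Rightarrow> 'a \<Rightarrow> 'a pmf" where
  "random_iterate m S w1 = do {
     R \<leftarrow> pmf_of_set {1..S};
     (ws, gc, pc) \<leftarrow> epochs m w1 R;
     T \<leftarrow> pmf_of_set {1..m};
     return_pmf (ws ! (T - 1)) }"

lemma set_random_iterate:
  assumes "1 \<le> m" "1 \<le> S" "w1 \<in> E" "w \<in> set_pmf (random_iterate m S w1)"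
  shows "w \<in> E"
proof -
  obtain R ws gc pc T where R: "R \<in> {1..S}" and T: "T \<in> {1..m}" and w: "w = ws ! (T - 1)"
    and ws: "(ws, gc, pc) \<in> set_pmf (epochs m w1 R)"
    using assms by (auto simp: random_iterate_def)
  from set_epochs[OF assms(3) ws] R T have "set ws \<subseteq> E" "T - 1 < length ws" by auto
  then show ?thesis unfolding w by (meson nth_mem subsetD)
qed

lemma finite_random_iterate:
  assumes "1 \<le> m" "1 \<le> S"
  shows "finite (set_pmf (random_iterate m S w1))"
  using assms by (auto simp: random_iterate_def finite_epochs)

lemma path_energy_eq:
  assumes "length ws = m + 1"
  shows "path_energy ws = (\<Sum>T=1..m. (norm (gmap (ws ! (T - 1))))\<^sup>2)"
proof -
  have "path_energy ws = (\<Sum>i<m. (norm (gmap (ws ! i)))\<^sup>2)"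
    using assms by (simp add: path_energy_def sum_list_sum_nth nth_butlast atLeast0LessThan)
  also have "\<dots> = (\<Sum>T=1..m. (norm (gmap (ws ! (T - 1))))\<^sup>2)"
    by (rule sum.reindex_bij_witness[of _ "\<lambda>T. T - 1" Suc]) auto
  finally show ?thesis .
qed

lemma expectation_random_iterate:
  assumes m: "1 \<le> m" and S: "1 \<le> S" and w1: "w1 \<in> E"
  shows "measure_pmf.expectation (random_iterate m S w1) (\<lambda>w. (norm (gmap w))\<^sup>2)
    = (\<Sum>r=1..S. measure_pmf.expectation (epochs m w1 r) (\<lambda>(ws, _). path_energy ws)) / (real S * real m)"
proof -
  have "measure_pmf.expectation (random_iterate m S w1) (\<lambda>w. (norm (gmap w))\<^sup>2)
    = (\<Sum>r=1..S. measure_pmf.expectation (epochs m w1 r)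
        (\<lambda>(ws, _). (\<Sum>T=1..m. (norm (gmap (ws ! (T - 1))))\<^sup>2) / real m)) / real S"
    unfolding random_iterate_def using m S
    by (simp add: expectation_bind_finite integral_pmf_of_set finite_epochs case_prod_unfold
        sum_divide_distrib[symmetric] mult.commute)
  also have "(\<Sum>r=1..S. measure_pmf.expectation (epochs m w1 r)
        (\<lambda>(ws, _). (\<Sum>T=1..m. (norm (gmap (ws ! (T - 1))))\<^sup>2) / real m))
    = (\<Sum>r=1..S. measure_pmf.expectation (epochs m w1 r) (\<lambda>(ws, _). path_energy ws) / real m)"
  proof (rule sum.cong[OF refl])
    fix r assume r: "r \<in> {1..S}"
    \<comment> \<open>The integrands agree on the support, where for \<open>r \<ge> 1\<close> every
      list has \<open>m + 1\<close> entries.\<close>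
    have "measure_pmf.expectation (epochs m w1 r)
        (\<lambda>(ws, _). (\<Sum>T=1..m. (norm (gmap (ws ! (T - 1))))\<^sup>2) / real m)
      = measure_pmf.expectation (epochs m w1 r) (\<lambda>(ws, _). path_energy ws / real m)"
      by (intro integral_cong_AE)
        (use r set_epochs[OF w1, of _ _ _ m r] in \<open>auto simp: AE_measure_pmf_iff path_energy_eq\<close>)
    then show "measure_pmf.expectation (epochs m w1 r)
        (\<lambda>(ws, _). (\<Sum>T=1..m. (norm (gmap (ws ! (T - 1))))\<^sup>2) / real m)
      = measure_pmf.expectation (epochs m w1 r) (\<lambda>(ws, _). path_energy ws) / real m"
      by (simp add: case_prod_unfold)
  qed
  finally show ?thesis by (simp add: sum_divide_distrib[symmetric] mult.commute)
qed

lemma random_iterate_stationary: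
  assumes m: "1 \<le> m" and S: "1 \<le> S" and w1: "w1 \<in> E" and min: "is_arg_min h (\<lambda>w. w \<in> E) wstar"
  shows "eps_stationary E h
    (sqrt (12 * (L + 1 / lam) * (h w1 - h wstar + l\<^sup>2 * lam / 2) / (real S * real m)) + 2 * L * l * lam)
    (map_pmf p (random_iterate m S w1))"
proof -
  let ?P = "random_iterate m S w1"
  note fin = finite_random_iterate[OF m S, of w1]
  have nonneg: "0 \<le> 2 * L * l * lam" using L_nonneg l_nonneg lam_pos by simp
  have "(\<integral>\<^sup>+ w. edist_set 0 (limiting_subdiff E h w) \<partial>measure_pmf (map_pmf p ?P))
      = (\<integral>\<^sup>+ w. edist_set 0 (limiting_subdiff E h (p w)) \<partial>measure_pmf ?P)"
    by simp
  also have "\<dots> \<le> (\<integral>\<^sup>+ w. ennreal (norm (gmap w) + 2 * L * l * lam) \<partial>measure_pmf ?P)"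
    by (intro nn_integral_mono_AE)
      (auto simp: AE_measure_pmf_iff intro: edist_limiting_subdiff_le set_random_iterate[OF m S w1])
  also have "\<dots> = ennreal (measure_pmf.expectation ?P (\<lambda>w. norm (gmap w) + 2 * L * l * lam))"
    using nonneg by (intro nn_integral_eq_integral integrable_measure_pmf_finite fin) (auto intro!: add_nonneg_nonneg)
  also have "measure_pmf.expectation ?P (\<lambda>w. norm (gmap w) + 2 * L * l * lam)
      = measure_pmf.expectation ?P (\<lambda>w. norm (gmap w)) + 2 * L * l * lam"
    by (simp add: integrable_measure_pmf_finite fin)
  also have "\<dots> \<le> sqrt (12 * (L + 1 / lam) * (h w1 - h wstar + l\<^sup>2 * lam / 2) / (real S * real m))
      + 2 * L * l * lam"
  proof (rule add_right_mono, rule order_trans[OF expectation_le_sqrt[OF fin]], rule real_sqrt_le_mono)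
    show "measure_pmf.expectation ?P (\<lambda>w. (norm (gmap w))\<^sup>2)
        \<le> 12 * (L + 1 / lam) * (h w1 - h wstar + l\<^sup>2 * lam / 2) / (real S * real m)"
      unfolding expectation_random_iterate[OF m S w1]
      by (intro divide_right_mono sum_path_energy_le m w1 min) simp
  qed
  finally show ?thesis by (simp add: eps_stationary_def ennreal_leI)
qed

text \<open>This is why \<theta> is 1/3: with \<open>lam = 1 / q\<close> and
  \<open>S * m = q ^ 3\<close>, the mean squared \<open>gmap\<close> is of order
  \<open>q / q ^ 3\<close>, so its root and the prox error, of order \<open>lam\<close>, both decay
  like \<open>1 / q\<close>.\<close>

lemma random_iterate_stationary_rate:
  assumes m: "1 \<le> m" and S: "1 \<le> S" and w1: "w1 \<in> E" and min: "is_arg_min h (\<lambda>w. w \<in> E) wstar"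
    and lam: "lam = 1 / q" and q: "1 \<le> q" "q ^ 3 = real S * real m"
    and \<epsilon>: "(sqrt (12 * (L + 1) * (h w1 - h wstar + l\<^sup>2 / 2)) + 2 * L * l) / q \<le> \<epsilon>"
  shows "eps_stationary E h \<epsilon> (map_pmf p (random_iterate m S w1))"
proof -
  have gap: "0 \<le> h w1 - h wstar" using min w1 by (simp add: is_arg_min_linorder)
  have "12 * (L + 1 / lam) * (h w1 - h wstar + l\<^sup>2 * lam / 2)
      \<le> 12 * (q * (L + 1)) * (h w1 - h wstar + l\<^sup>2 / 2)"
  proof (intro mult_mono add_left_mono)
    have "L * 1 \<le> L * q" using L_nonneg q by (intro mult_left_mono) auto
    then show "L + 1 / lam \<le> q * (L + 1)" by (simp add: lam algebra_simps)
    show "l\<^sup>2 * lam / 2 \<le> l\<^sup>2 / 2" using mult_right_mono[OF q(1), of "l\<^sup>2"] q(1) by (simp add: lam field_simps)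
  qed (use L_nonneg q gap lam_pos in auto)
  then have "12 * (L + 1 / lam) * (h w1 - h wstar + l\<^sup>2 * lam / 2) / (real S * real m)
      \<le> 12 * (q * (L + 1)) * (h w1 - h wstar + l\<^sup>2 / 2) / q ^ 3"
    using q by (simp add: divide_right_mono)
  also have "\<dots> = 12 * (L + 1) * (h w1 - h wstar + l\<^sup>2 / 2) / q\<^sup>2"
    using q(1) by (simp add: power2_eq_square power3_eq_cube)
  finally have "sqrt (12 * (L + 1 / lam) * (h w1 - h wstar + l\<^sup>2 * lam / 2) / (real S * real m))
      \<le> sqrt (12 * (L + 1) * (h w1 - h wstar + l\<^sup>2 / 2)) / sqrt (q\<^sup>2)"
    unfolding real_sqrt_divide[symmetric] by (rule real_sqrt_le_mono)
  moreover have "sqrt (q\<^sup>2) = q" using q(1) by simp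
  ultimately have "sqrt (12 * (L + 1 / lam) * (h w1 - h wstar + l\<^sup>2 * lam / 2) / (real S * real m))
      + 2 * L * l * lam \<le> \<epsilon>"
    using \<epsilon> by (simp add: lam add_divide_distrib)
  with random_iterate_stationary[OF m S w1 min] show ?thesis
    unfolding eps_stationary_def by (meson ennreal_leI order_trans)
qed

end

section \<open>The instance \<open>Rn d\<close>, rounding of the parameters, and operation
  counts\<close>

lemma prox_finite_sum_Rn:
  assumes d: "1 \<le> d" and n: "1 \<le> n" and lam: "0 < lam"
    and F: "\<forall>j\<in>{1..n}. smooth_on L (Rn d) (F j)"
    and g: "l-lipschitz_on (Rn d) g"
    and p: "\<And>w. w \<in> Rn d \<Longrightarrow> p w \<in> prox (Rn d) lam g w"
  shows "prox_finite_sum (Rn d) n F L g l lam p"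
proof
  \<comment> \<open>Nonnegativity of \<open>L\<close> follows from the Lipschitz inequality at two
    distinct points, which exist because \<open>d \<ge> 1\<close>.\<close>
  have u: "unit_seqvec 0 \<in> Rn d" "0 \<in> Rn d" using d by (auto simp: Rn_def)
  have "norm (unit_seqvec 0) > 0"
  proof -
    have "coord (unit_seqvec 0) 0 \<noteq> coord 0 0" by simp
    then show ?thesis by (metis zero_less_norm_iff)
  qed
  moreover have "0 \<le> L * norm (unit_seqvec 0 - 0)"
    using F n u norm_ge_zero order_trans unfolding smooth_on_def by (metis atLeastAtMost_iff order_refl)
  ultimately show "0 \<le> L" by (simp add: zero_le_mult_iff)
  show "subspace (Rn d)" by (rule subspace_Rn)
qed (use assms in \<open>auto simp: smooth_on_def intro: grad_in_Rn has_derivative_grad_Rn\<close>)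

text \<open>The quantity \<open>m ^ 3\<close> is the number of indices sampled per epoch; it must be
  of the order of \<open>n\<close>, the cost of a full gradient.\<close>

lemma ceiling_cbrt_bounds:
  assumes "1 \<le> n"
  defines "m \<equiv> nat \<lceil>real n powr (1/3)\<rceil>"
  shows "1 \<le> m" "real n powr (1/3) \<le> real m" "real m ^ 3 \<le> 8 * real n"
proof -
  define r where "r = real n powr (1/3)"
  have r1: "1 \<le> r" unfolding r_def using assms(1) by (intro ge_one_powr_ge_zero) auto
  have r3: "r ^ 3 = real n"
    unfolding r_def using assms(1) by (simp add: powr_power)
  have m: "real m = of_int \<lceil>r\<rceil>" using r1 unfolding m_def r_def[symmetric] by simp
  show le: "real n powr (1/3) \<le> real m" unfolding r_def[symmetric] m by simp
  then show "1 \<le> m" using r1 by (simp add: r_def[symmetric])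
  have "real m \<le> 2 * r" unfolding m using r1 by linarith
  then have "real m ^ 3 \<le> (2 * r) ^ 3" by (intro power_mono) auto
  then show "real m ^ 3 \<le> 8 * real n" by (simp add: power_mult_distrib r3)
qed

lemma ceiling_quotient_bounds:
  fixes N m :: nat
  assumes "1 \<le> m" "m \<le> N"
  defines "S \<equiv> nat \<lceil>real N / real m\<rceil>"
  shows "1 \<le> S" "real N \<le> real S * real m" "real S * real m \<le> 2 * real N"
proof -
  have q: "1 \<le> real N / real m" using assms by (simp add: field_simps)
  then have S: "real S = of_int \<lceil>real N / real m\<rceil>" by (simp add: S_def)
  have le: "real N / real m \<le> real S" unfolding S by simp
  then show "1 \<le> S" using q by simp
  show "real N \<le> real S * real m" using le assms(1) by (simp add: field_simps)
  have "real S \<le> 2 * (real N / real m)" unfolding S using q by linarith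
  then show "real S * real m \<le> 2 * real N" using assms(1) by (simp add: field_simps)
qed

text \<open>\<open>N\<close> controls both sides: \<open>N \<le> S * m\<close> gives the accuracy,
  and \<open>S * m \<le> 2 * N\<close>, valid since \<open>m \<le> N\<close>, limits the
  cost.\<close>

lemma vrsga_stationary_and_counts:
  fixes d n N :: nat
  assumes d: "1 \<le> d" and n: "1 \<le> n"
    and F: "\<forall>j\<in>{1..n}. smooth_on L (Rn d) (F j)"
    and g: "l-lipschitz_on (Rn d) g"
    and \<zeta>: "\<forall>lam>0. \<forall>w\<in>Rn d. \<zeta> lam w \<in> prox (Rn d) lam g w"
    and h: "h = (\<lambda>w. finite_avg n F w + g w)"
    and min: "is_arg_min h (\<lambda>w. w \<in> Rn d) wstar" and w1: "w1 \<in> Rn d"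
  defines "m \<equiv> nat \<lceil>real n powr (1/3)\<rceil>"
  assumes mN: "m \<le> N"
    and \<epsilon>: "0 < \<epsilon>" "((sqrt (12 * (L + 1) * (h w1 - h wstar + l\<^sup>2 / 2)) + 2 * L * l) / \<epsilon>) ^ 3 \<le> real N"
  defines "run \<equiv> vrsga (Rn d) n F L \<zeta> w1 N (1/3) (1/3)"
  shows "eps_stationary (Rn d) h \<epsilon> (map_pmf fst run)"
    and "(w, gcalls, pops) \<in> set_pmf run \<Longrightarrow> real gcalls \<le> 34 * real n powr (2/3) * real N"
    and "(w, gcalls, pops) \<in> set_pmf run \<Longrightarrow> real pops \<le> 3 * real N"
proof -
  define S where "S = nat \<lceil>real N / real m\<rceil>"
  define q where "q = real (S * m) powr (1/3)"
  note m = ceiling_cbrt_bounds[OF n, folded m_def]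
  note S = ceiling_quotient_bounds[OF m(1) mN, folded S_def]
  have Sm: "1 \<le> S * m" using m(1) S(1) by simp
  then have q1: "1 \<le> q" unfolding q_def by (intro ge_one_powr_ge_zero) (auto simp del: of_nat_mult)
  have q3: "q ^ 3 = real S * real m" unfolding q_def using Sm by (simp add: powr_power)
  have lam: "real (S * m) powr (- (1/3)) = 1 / q" unfolding q_def by (simp add: powr_minus_divide)
  interpret prox_finite_sum "Rn d" n F L g l "1 / q" "\<zeta> (1 / q)"
    using d n F g \<zeta> q1 by (intro prox_finite_sum_Rn) auto
  have run: "run = do {
      R \<leftarrow> pmf_of_set {1..S};
      (ws, gc, pc) \<leftarrow> epochs m w1 R;
      T \<leftarrow> pmf_of_set {1..m};
      return_pmf (\<zeta> (1 / q) (ws ! (T - 1)), gc, pc + 1) }"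
    unfolding run_def vrsga_def Let_def m_def[symmetric] S_def[symmetric] lam stepsize_def ..
  have "map_pmf fst run = map_pmf (\<zeta> (1 / q)) (random_iterate m S w1)"
    unfolding run random_iterate_def
    by (simp add: map_bind_pmf case_prod_unfold)
  moreover have "eps_stationary (Rn d) h \<epsilon> (map_pmf (\<zeta> (1 / q)) (random_iterate m S w1))"
    unfolding h
  proof (rule random_iterate_stationary_rate[OF m(1) S(1) w1 _ refl q1 q3])
    show "is_arg_min (\<lambda>w. finite_avg n F w + g w) (\<lambda>w. w \<in> Rn d) wstar" using min h by simp
    let ?K = "sqrt (12 * (L + 1) * (h w1 - h wstar + l\<^sup>2 / 2)) + 2 * L * l"
    have "(?K / \<epsilon>) ^ 3 \<le> q ^ 3" using \<epsilon>(2) S(2) unfolding q3 by linarith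
    then have "?K / \<epsilon> \<le> q" using q1 by (rule_tac power_le_imp_le_base[of _ 2]) (auto simp: numeral_3_eq_3)
    then have "?K / q \<le> \<epsilon>" using \<epsilon>(1) q1 by (simp add: field_simps)
    then show "(sqrt (12 * (L + 1) * (finite_avg n F w1 + g w1 - (finite_avg n F wstar + g wstar) + l\<^sup>2 / 2))
        + 2 * L * l) / q \<le> \<epsilon>" by (simp add: h)
  qed
  ultimately show "eps_stationary (Rn d) h \<epsilon> (map_pmf fst run)" by simp
  assume "(w, gcalls, pops) \<in> set_pmf run"
  then obtain R ws gc pc where R: "R \<in> {1..S}" and ws: "(ws, gc, pc) \<in> set_pmf (epochs m w1 R)"
    and gp: "gcalls = gc" "pops = pc + 1"
    unfolding run using S(1) m(1) by auto
  from set_epochs[OF w1 ws] have counts: "gcalls = R * (n + 2 * m\<^sup>2 * m)" "pops = R * m + 1"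
    by (auto simp: gp)
  have RS: "real R \<le> real S" using R by simp
  \<comment> \<open>By \<open>m ^ 3 \<le> 8 * n\<close> an epoch costs at most \<open>17 * n\<close>
    calls. One factor \<open>n powr (1/3)\<close> is then absorbed by \<open>m\<close>, so that
    \<open>S * m\<close> appears.\<close>
  have "real gcalls = real R * (real n + 2 * real m ^ 3)"
    by (simp add: counts power2_eq_square power3_eq_cube)
  also have "\<dots> \<le> real S * (17 * real n)" using RS m(3) by (intro mult_mono) auto
  also have "\<dots> = 17 * real n powr (2/3) * (real S * real n powr (1/3))"
    using n by (simp add: mult_ac powr_add[symmetric])
  also have "\<dots> \<le> 17 * real n powr (2/3) * (2 * real N)"
    using m(2) S(3) by (intro mult_left_mono order_trans[OF mult_left_mono S(3)]) auto
  finally show "real gcalls \<le> 34 * real n powr (2/3) * real N" by simp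
  have "real pops \<le> real S * real m + 1" using RS by (simp add: counts mult_right_mono)
  also have "\<dots> \<le> 3 * real N" using S(3) m(1) mN by simp
  finally show "real pops \<le> 3 * real N" .
qed

theorem corollary9:
  fixes L l \<Delta> :: real
  shows "\<exists>C. \<forall>(d::nat) (n::nat) (F :: nat \<Rightarrow> seqvec \<Rightarrow> real) (g :: seqvec \<Rightarrow> real)
      (\<zeta> :: real \<Rightarrow> seqvec \<Rightarrow> seqvec) (wstar :: seqvec) (w1 :: seqvec) (h :: seqvec \<Rightarrow> real).
    d \<ge> 1 \<longrightarrow> n \<ge> 1 \<longrightarrow>
    (\<forall>j\<in>{1..n}. smooth_on L (Rn d) (F j)) \<longrightarrow>
    l-lipschitz_on (Rn d) g \<longrightarrow>
    (\<forall>lam>0. \<forall>w\<in>Rn d. prox (Rn d) lam g w \<noteq> {}) \<longrightarrow>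
    (\<forall>lam>0. \<zeta> lam \<in> borel_measurable (restrict_space borel (Rn d)) \<and>
            (\<forall>w\<in>Rn d. \<zeta> lam w \<in> prox (Rn d) lam g w)) \<longrightarrow>
    h = (\<lambda>w. finite_avg n F w + g w) \<longrightarrow>
    is_arg_min h (\<lambda>w. w \<in> Rn d) wstar \<longrightarrow>
    w1 \<in> Rn d \<longrightarrow>
    \<Delta> = 36 * (h w1 - h wstar) \<longrightarrow>
    (\<exists>\<epsilon>0>0. \<forall>\<epsilon>. 0 < \<epsilon> \<and> \<epsilon> < \<epsilon>0 \<longrightarrow>
      (\<exists>N::nat. N > 0 \<and>
        (let run = vrsga (Rn d) n F L \<zeta> w1 N (1/3) (1/3) in
          eps_stationary (Rn d) h \<epsilon> (map_pmf fst run) \<and>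
          (\<forall>(w, gcalls, pops) \<in> set_pmf run.
             real gcalls \<le> C * real n powr (2/3) * \<epsilon> powr (-3) \<and>
             real pops \<le> C * \<epsilon> powr (-3)))))"
proof -
  \<comment> \<open>The stationarity bound is \<open>K / q\<close>; by the choice of \<Delta> it
    involves only \<open>L\<close>, \<open>l\<close> and \<Delta>.\<close>
  define K where "K = sqrt (12 * (L + 1) * (\<Delta> / 36 + l\<^sup>2 / 2)) + 2 * L * l"
  \<comment> \<open>The maximum with 1 ensures \<open>A \<ge> 1\<close>, so \<open>N\<close> below
    is at least \<epsilon> to the power -3.\<close>
  define A where "A = (max K 1) ^ 3"
  have A1: "1 \<le> A" unfolding A_def by (intro one_le_power) simp
  show ?thesis
  \<comment> \<open>68 is 34 from the gradient count times 2 from rounding \<open>x\<close> up to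
    \<open>N\<close>; it also covers the prox count.\<close>
  proof (rule exI[of _ "68 * A"], intro allI impI)
    fix d n :: nat and F g \<zeta> wstar w1 and h :: "seqvec \<Rightarrow> real"
    assume d: "1 \<le> d" and n: "1 \<le> n"
      and F: "\<forall>j\<in>{1..n}. smooth_on L (Rn d) (F j)"
      and g: "l-lipschitz_on (Rn d) g"
      and \<zeta>: "\<forall>lam>0. \<zeta> lam \<in> borel_measurable (restrict_space borel (Rn d)) \<and>
            (\<forall>w\<in>Rn d. \<zeta> lam w \<in> prox (Rn d) lam g w)"
      and h: "h = (\<lambda>w. finite_avg n F w + g w)"
      and min: "is_arg_min h (\<lambda>w. w \<in> Rn d) wstar" and w1: "w1 \<in> Rn d"
      and \<Delta>: "\<Delta> = 36 * (h w1 - h wstar)"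
    define m where "m = nat \<lceil>real n powr (1/3)\<rceil>"
    note m = ceiling_cbrt_bounds[OF n, folded m_def]
    show "\<exists>\<epsilon>0>0. \<forall>\<epsilon>. 0 < \<epsilon> \<and> \<epsilon> < \<epsilon>0 \<longrightarrow>
      (\<exists>N::nat. N > 0 \<and>
        (let run = vrsga (Rn d) n F L \<zeta> w1 N (1/3) (1/3) in
          eps_stationary (Rn d) h \<epsilon> (map_pmf fst run) \<and>
          (\<forall>(w, gcalls, pops) \<in> set_pmf run.
             real gcalls \<le> 68 * A * real n powr (2/3) * \<epsilon> powr (-3) \<and>
             real pops \<le> 68 * A * \<epsilon> powr (-3))))"
    \<comment> \<open>Below this threshold \<open>m\<close> is less than 1/\<epsilon>, hence at most
      \<open>x\<close> and at most \<open>N\<close>, as the counting lemma requires; only the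
      threshold depends on \<open>n\<close>.\<close>
    proof (rule exI[of _ "1 / real m"], intro conjI allI impI)
      show "0 < 1 / real m" using m(1) by simp
      fix \<epsilon> :: real assume "0 < \<epsilon> \<and> \<epsilon> < 1 / real m"
      then have \<epsilon>: "0 < \<epsilon>" "real m < 1 / \<epsilon>" using m(1) by (simp_all add: field_simps)
      define x where "x = A * \<epsilon> powr (-3)"
      define N where "N = nat \<lceil>x\<rceil>"
      have e3: "\<epsilon> powr (-3) = (1 / \<epsilon>) ^ 3"
        using \<epsilon>(1) by (simp add: powr_minus_divide power_one_over powr_numeral)
      have e1: "1 \<le> 1 / \<epsilon>" using \<epsilon>(2) m(1) by simp
      have mx: "real m \<le> x"
      proof -
        have "1 / \<epsilon> \<le> (1 / \<epsilon>) ^ 3" using e1 by (rule self_le_power) simp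
        also have "\<dots> \<le> x" unfolding x_def e3 using A1 \<epsilon>(1) by (simp add: mult_right_mono)
        finally show ?thesis using \<epsilon>(2) by simp
      qed
      have x1: "1 \<le> x" using mx m(1) by linarith
      have Nx: "x \<le> real N" "real N \<le> 2 * x" unfolding N_def using x1 by linarith+
      have mN: "m \<le> N" using mx Nx(1) by linarith
      \<comment> \<open>An odd power is monotone on all reals, so this holds for either sign of
        \<open>K\<close>.\<close>
      have "(K / \<epsilon>) ^ 3 \<le> (max K 1 / \<epsilon>) ^ 3"
        using \<epsilon>(1) by (intro power_mono_odd divide_right_mono) auto
      also have "\<dots> = x" by (simp add: x_def e3 A_def power_divide)
      finally have "(K / \<epsilon>) ^ 3 \<le> real N" using Nx(1) by linarith
      moreover have "\<Delta> / 36 = h w1 - h wstar" using \<Delta> by simp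
      ultimately have KN: "((sqrt (12 * (L + 1) * (h w1 - h wstar + l\<^sup>2 / 2)) + 2 * L * l) / \<epsilon>) ^ 3 \<le> real N"
        by (simp only: K_def)
      have \<zeta>': "\<forall>lam>0. \<forall>w\<in>Rn d. \<zeta> lam w \<in> prox (Rn d) lam g w"
        using \<zeta> by blast
      note * = vrsga_stationary_and_counts[OF d n F g \<zeta>' h min w1 mN[unfolded m_def] \<epsilon>(1) KN]
      show "\<exists>N::nat. N > 0 \<and>
        (let run = vrsga (Rn d) n F L \<zeta> w1 N (1/3) (1/3) in
          eps_stationary (Rn d) h \<epsilon> (map_pmf fst run) \<and>
          (\<forall>(w, gcalls, pops) \<in> set_pmf run.
             real gcalls \<le> 68 * A * real n powr (2/3) * \<epsilon> powr (-3) \<and>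
             real pops \<le> 68 * A * \<epsilon> powr (-3)))"
        unfolding Let_def
      proof (rule exI[of _ N], rule conjI)
        show "0 < N" using mN m(1) by simp
        have "real gcalls \<le> 68 * A * real n powr (2/3) * \<epsilon> powr (-3) \<and> real pops \<le> 68 * A * \<epsilon> powr (-3)"
          if run: "(w, gcalls, pops) \<in> set_pmf (vrsga (Rn d) n F L \<zeta> w1 N (1/3) (1/3))" for w gcalls pops
        proof
          have "real gcalls \<le> 34 * real n powr (2/3) * (2 * x)"
            using *(2)[OF run] Nx(2) by (rule order_trans[OF _ mult_left_mono]) auto
          then show "real gcalls \<le> 68 * A * real n powr (2/3) * \<epsilon> powr (-3)"
            by (simp add: x_def mult_ac)
          have "real pops \<le> 68 * x" using *(3)[OF run] Nx(2) x1 by linarith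
          then show "real pops \<le> 68 * A * \<epsilon> powr (-3)" by (simp add: x_def mult_ac)
        qed
        with *(1) show "eps_stationary (Rn d) h \<epsilon> (map_pmf fst (vrsga (Rn d) n F L \<zeta> w1 N (1/3) (1/3))) \<and>
          (\<forall>(w, gcalls, pops) \<in> set_pmf (vrsga (Rn d) n F L \<zeta> w1 N (1/3) (1/3)).
             real gcalls \<le> 68 * A * real n powr (2/3) * \<epsilon> powr (-3) \<and>
             real pops \<le> 68 * A * \<epsilon> powr (-3))"
          by auto
      qed
    qed
  qed
qed

end
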